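(* Let $\sigma=\{\sigma_i\mid i\in I\}$ be a partition of the set $\mathbb{P}$ of all primes. Suppose that a finite group $G$ possesses a complete Hall $\sigma$-set $\mathcal H=\{1,H_1,\ldots,H_t\}$ such that $H_i$ is nilpotent for all $i=1,\ldots,t$. Then $G$ has an $H_\sigma$-normally embedded subgroup of order $|H|$ for each subgroup $H$ of $G$ if and only if the nilpotent residual $D=G^{\mathfrak N}$ of $G$ is cyclic of square-free order and $|\sigma_i\cap\pi(G)|=1$ for all $i$ such that $\sigma_i\cap\pi(D)\neq\emptyset$.
   Context: All groups are finite. $\pi(n)$ is the set of primes dividing $n$, $\pi(G)=\pi(|G|)$. $\sigma=\{\sigma_i\mid i\in I\}$ is a partition of $\mathbb P$; $\sigma(n)=\{\sigma_i\mid \sigma_i\cap\pi(n)\neq\emptyset\}$ and $\sigma(G)=\sigma(|G|)$. A set $\mathcal H$ of subgroups of $G$ is a complete Hall $\sigma$-set of $G$ if every member of $\mathcal H\setminus\{1\}$ is a Hall $\sigma_i$-subgroup of $G$ for some $i$ and $\mathcal H$ contains exactly one Hall $\sigma_i$-subgroup of $G$ for every $\sigma_i\in\sigma(G)$. A subgroup $A$ of $G$ is a $\sigma$-Hall subgroup of $G$ if $\sigma(|A|)\cap\sigma(|G:A|)=\emptyset$. $A$ is $H_\sigma$-normally embedded in $G$ if $A$ is a $\sigma$-Hall subgroup of some normal subgroup of $G$. The nilpotent residual $G^{\mathfrak N}$ is the intersection of all normal subgroups $N$ of $G$ with $G/N$ nilpotent. *)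

theory Defs
  imports
    "HOL-Algebra.Algebra"
    "HOL-Library.Disjoint_Sets"
    "HOL-Computational_Algebra.Squarefree"
begin

section \<open>Nilpotent groups and the nilpotent residual\<close>

definition commutator_subgroup :: "('a, 'b) monoid_scheme \<Rightarrow> 'a set \<Rightarrow> 'a set \<Rightarrow> 'a set" where
  "commutator_subgroup G A B =
     generate G {a \<otimes>\<^bsub>G\<^esub> b \<otimes>\<^bsub>G\<^esub> inv\<^bsub>G\<^esub> a \<otimes>\<^bsub>G\<^esub> inv\<^bsub>G\<^esub> b | a b. a \<in> A \<and> b \<in> B}"

definition lower_central :: "('a, 'b) monoid_scheme \<Rightarrow> nat \<Rightarrow> 'a set" where
  "lower_central G n = ((\<lambda>K. commutator_subgroup G K (carrier G)) ^^ n) (carrier G)"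

definition nilpotent :: "('a, 'b) monoid_scheme \<Rightarrow> bool" where
  "nilpotent G \<longleftrightarrow> group G \<and> (\<exists>n. lower_central G n = {\<one>\<^bsub>G\<^esub>})"

definition nilpotent_residual :: "('a, 'b) monoid_scheme \<Rightarrow> 'a set" where
  "nilpotent_residual G = \<Inter>{N. N \<lhd> G \<and> nilpotent (G Mod N)}"


section \<open>Sets of primes and Hall subgroups\<close>

text \<open>
  Throughout, \<open>\<sigma>\<close> is a set of pairwise disjoint nonempty sets of primes covering all primes, so
  its blocks are referred to directly rather than through an index set. The set
  \<open>\<pi>(n)\<close> of prime divisors of \<open>n\<close> is \<^const>\<open>prime_factors\<close> (used only for \<open>n > 0\<close>), and
  the index \<open>|G : A|\<close> is the number of right cosets.
\<close>

definition sigma_of :: "nat set set \<Rightarrow> nat \<Rightarrow> nat set set" where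
  "sigma_of \<sigma> n = {s \<in> \<sigma>. s \<inter> prime_factors n \<noteq> {}}"

definition Hall_subgroup :: "nat set \<Rightarrow> 'a set \<Rightarrow> ('a, 'b) monoid_scheme \<Rightarrow> bool" where
  "Hall_subgroup s A G \<longleftrightarrow>
     subgroup A G \<and> prime_factors (card A) \<subseteq> s \<and>
     prime_factors (card (rcosets\<^bsub>G\<^esub> A)) \<inter> s = {}"

definition complete_Hall_sigma_set ::
    "nat set set \<Rightarrow> 'a set set \<Rightarrow> ('a, 'b) monoid_scheme \<Rightarrow> bool" where
  "complete_Hall_sigma_set \<sigma> \<H> G \<longleftrightarrow>
     (\<forall>A \<in> \<H>. subgroup A G) \<and>
     (\<forall>A \<in> \<H> - {{\<one>\<^bsub>G\<^esub>}}. \<exists>s \<in> \<sigma>. Hall_subgroup s A G) \<and>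
     (\<forall>s \<in> sigma_of \<sigma> (order G). \<exists>!A. A \<in> \<H> \<and> Hall_subgroup s A G)"

definition sigma_Hall_subgroup ::
    "nat set set \<Rightarrow> 'a set \<Rightarrow> ('a, 'b) monoid_scheme \<Rightarrow> bool" where
  "sigma_Hall_subgroup \<sigma> A G \<longleftrightarrow>
     subgroup A G \<and> sigma_of \<sigma> (card A) \<inter> sigma_of \<sigma> (card (rcosets\<^bsub>G\<^esub> A)) = {}"

definition H_sigma_normally_embedded ::
    "nat set set \<Rightarrow> 'a set \<Rightarrow> ('a, 'b) monoid_scheme \<Rightarrow> bool" where
  "H_sigma_normally_embedded \<sigma> A G \<longleftrightarrow>
     (\<exists>N. N \<lhd> G \<and> sigma_Hall_subgroup \<sigma> A (G\<lparr>carrier := N\<rparr>))"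

end

theory Submission
  imports Defs
begin

text \<open>
  Forward direction. For \<open>p \<in> \<sigma>\<^sub>i\<close> dividing \<open>|G|\<close>, a subgroup of order \<open>p\<close> yields a normal \<open>N\<close>
  whose \<open>\<sigma>\<^sub>i\<close>-part is \<open>p\<close>. If \<open>|N|\<close> is maximal and a prime \<open>r \<notin> \<sigma>\<^sub>i\<close> divided \<open>|G : N|\<close>, the hypothesis for
  a subgroup of order \<open>r |N|\<close> containing \<open>N\<close> would produce a larger such normal subgroup. So
  \<open>G/N\<close> is a \<open>\<sigma>\<^sub>i\<close>-group, hence an image of the nilpotent \<open>H\<^sub>i\<close>, and \<open>D \<le> N\<close>: the \<open>\<sigma>\<^sub>i\<close>-part of
  \<open>|D|\<close> divides every prime in \<open>\<sigma>\<^sub>i \<inter> \<pi>(G)\<close>. In particular \<open>|D|\<close> is square-free, so the Sylow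
  subgroup \<open>Q\<close> of \<open>D\<close> for its largest prime is characteristic; it is centralized by \<open>G' \<ge> D\<close>
  because the automorphism group of \<open>Q\<close> is abelian, and \<open>D\<close> is cyclic by induction in \<open>G/Q\<close>.

  Backward direction. Let \<open>k\<close> be the product of the primes dividing \<open>|D|\<close> but not \<open>|H|\<close>. The
  nilpotent group \<open>G/D\<close> has normal subgroups of all possible orders, so some normal \<open>N \<ge> D\<close> has order
  \<open>k |H|\<close>. The subgroup of \<open>D\<close> of order \<open>k\<close> has a complement \<open>A\<close> in \<open>N\<close> by Schur--Zassenhaus, and
  \<open>A\<close> is \<open>\<sigma>\<close>-Hall in \<open>N\<close>.
\<close>

section \<open>Complements of abelian normal Hall subgroups\<close>

lemma (in group_hom) card_image_times_card_kernel:
  "card (h ` carrier G) * card (kernel G H h) = order G"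
proof -
  interpret I: group_hom G "H\<lparr>carrier := h ` carrier G\<rparr>" h
    using G.is_group H.subgroup_imp_group img_is_subgroup
    by (auto intro!: group_hom.intro group_hom_axioms.intro homI)
  have K: "kernel G (H\<lparr>carrier := h ` carrier G\<rparr>) h = kernel G H h"
    by (simp add: kernel_def)
  have "card (rcosets kernel G H h) = card (h ` carrier G)"
    using iso_same_card[OF I.FactGroup_iso] by (simp add: K FactGroup_def)
  then show ?thesis
    using G.lagrange[OF subgroup_kernel] by simp
qed

text \<open>The representative is chosen from the coset, so it depends on the coset alone.
  Congruences modulo \<open>H\<close> thereby turn into equations between values of
  \<open>t\<close>.\<close>

lemma (in normal) coset_representatives:
  obtains t where "\<And>x. x \<in> carrier G \<Longrightarrow> t x \<in> carrier G"
    and "\<And>x. x \<in> carrier G \<Longrightarrow> H #> t x = H #> x"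
    and "\<And>x y. H #> x = H #> y \<Longrightarrow> t x = t y"
proof
  let ?t = "\<lambda>x. SOME y. y \<in> H #> x"
  have t: "?t x \<in> H #> x" if "x \<in> carrier G" for x
    using that rcos_self subgroup_axioms by (meson someI)
  show "?t x \<in> carrier G" if "x \<in> carrier G" for x
    using t[OF that] that r_coset_subset_G subset by blast
  show "H #> ?t x = H #> x" if "x \<in> carrier G" for x
    using repr_independence[OF t[OF that] that subgroup_axioms] by simp
  show "?t x = ?t y" if "H #> x = H #> y" for x y
    using that by simp
qed

lemma (in normal) rcos_mult_cong:
  assumes "H #> x = H #> x'" "H #> y = H #> y'"
    and "x \<in> carrier G" "x' \<in> carrier G" "y \<in> carrier G" "y' \<in> carrier G"
  shows "H #> (x \<otimes> y) = H #> (x' \<otimes> y')"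
  using assms rcos_sum by metis

lemma (in subgroup) mult_inv_mem_iff:
  assumes "group G" "x \<in> carrier G" "y \<in> carrier G"
  shows "x \<otimes> inv y \<in> H \<longleftrightarrow> H #> x = H #> y"
proof -
  interpret group G by fact
  have "x \<in> H #> y \<longleftrightarrow> x \<otimes> inv y \<in> H"
    using rcos_module[OF is_group] assms by blast
  moreover have "x \<in> H #> y \<longleftrightarrow> H #> x = H #> y"
    using assms repr_independence rcos_self subgroup_axioms by metis
  ultimately show ?thesis by blast
qed

text \<open>Taking the product over \<open>z\<close> in the cocycle identity for the factor set \<open>f\<close> shows that
  \<open>f\<close> to the power \<open>|G : H|\<close> is the coboundary of \<open>c\<close>; since \<open>|G : H|\<close> is invertible modulo \<open>|H|\<close>,
  a power of \<open>c\<close> corrects the section \<open>t\<close> to a homomorphism.\<close>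

theorem (in normal) abelian_normal_complement_hom:
  assumes fin: "finite (carrier G)"
    and comm: "\<And>a b. a \<in> H \<Longrightarrow> b \<in> H \<Longrightarrow> a \<otimes> b = b \<otimes> a"
    and cop: "coprime (card H) (card (rcosets H))"
  obtains s where "s \<in> hom G G" "kernel G G s = H"
    "\<And>x. x \<in> carrier G \<Longrightarrow> s x \<otimes> inv x \<in> H"
proof -
  define K where "K = G\<lparr>carrier := H\<rparr>"
  interpret K: comm_group K
    unfolding K_def using comm by (intro group.group_comm_groupI subgroup_imp_group subgroup_axioms) auto
  have Kc[simp]: "carrier K = H" and Km[simp]: "monoid.mult K = (\<otimes>)" and K1[simp]: "\<one>\<^bsub>K\<^esub> = \<one>"
    by (auto simp: K_def)
  have Kp[simp]: "x [^]\<^bsub>K\<^esub> (n::nat) = x [^] n" for x n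
    unfolding K_def by (rule nat_pow_consistent[symmetric])
  have finH: "finite H" using fin subset finite_subset by blast
  obtain t where tc[simp]: "\<And>x. x \<in> carrier G \<Longrightarrow> t x \<in> carrier G"
    and tH: "\<And>x. x \<in> carrier G \<Longrightarrow> H #> t x = H #> x"
    and teq: "\<And>x y. H #> x = H #> y \<Longrightarrow> t x = t y"
    using coset_representatives by blast
  define T where "T = t ` carrier G"
  have Tc: "T \<subseteq> carrier G" by (auto simp: T_def)
  have finT: "finite T" using fin by (simp add: T_def)
  have tT: "t z = z" if "z \<in> T" for z
    using that teq[OF tH] by (auto simp: T_def)
  have cT: "card T = card (rcosets H)"
  proof (rule bij_betw_same_card[of "\<lambda>x. H #> x"])
    have "inj_on (\<lambda>x. H #> x) T"
      by (rule inj_onI) (metis teq tT)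
    moreover have "(\<lambda>x. H #> x) ` T = (\<lambda>x. H #> x) ` carrier G"
      unfolding T_def image_image using tH by (rule image_cong[OF refl])
    then have "(\<lambda>x. H #> x) ` T = rcosets H"
      by (auto simp: RCOSETS_def)
    ultimately show "bij_betw (\<lambda>x. H #> x) T (rcosets H)" by (simp add: bij_betw_def)
  qed
  define f where "f x y = t x \<otimes> t y \<otimes> inv (t (x \<otimes> y))" for x y
  have fH[simp]: "f x y \<in> H" if "x \<in> carrier G" "y \<in> carrier G" for x y
    unfolding f_def using that rcos_mult_cong[of "t x" x "t y" y] mult_inv_mem_iff[of "t x \<otimes> t y" "t (x \<otimes> y)"]
    by (simp add: tH)
  have fc[simp]: "f x y \<in> carrier G" if "x \<in> carrier G" "y \<in> carrier G" for x y
    using that fH subset by blast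
  have ft: "t x \<otimes> t y = f x y \<otimes> t (x \<otimes> y)" if "x \<in> carrier G" "y \<in> carrier G" for x y
    unfolding f_def using that by (simp add: m_assoc)
  define j where "j g a = g \<otimes> a \<otimes> inv g" for g a
  have jH[simp]: "j g a \<in> H" if "g \<in> carrier G" "a \<in> H" for g a
    unfolding j_def using that inv_op_closed2 by simp
  have jc[simp]: "j g a \<in> carrier G" if "g \<in> carrier G" "a \<in> carrier G" for g a
    unfolding j_def using that by simp
  have jm: "j g (a \<otimes> b) = j g a \<otimes> j g b" if "g \<in> carrier G" "a \<in> carrier G" "b \<in> carrier G" for g a b
    unfolding j_def using that by (simp add: m_assoc inv_solve_left)
  have jg: "j g a \<otimes> g = g \<otimes> a" if "g \<in> carrier G" "a \<in> carrier G" for g a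
    unfolding j_def using that by (simp add: m_assoc)
  \<comment> \<open>Associativity of \<open>t x \<otimes> t y \<otimes> t z\<close>: both
    bracketings are an element of \<open>H\<close> times
    \<open>t (x \<otimes> y \<otimes> z)\<close>, and this right factor cancels.\<close>
  have cocycle: "f x y \<otimes> f (x \<otimes> y) z = j (t x) (f y z) \<otimes> f x (y \<otimes> z)"
    if c: "x \<in> carrier G" "y \<in> carrier G" "z \<in> carrier G" for x y z
  proof -
    have "f x y \<otimes> f (x \<otimes> y) z \<otimes> t (x \<otimes> y \<otimes> z) = f x y \<otimes> (f (x \<otimes> y) z \<otimes> t (x \<otimes> y \<otimes> z))"
      using c by (simp add: m_assoc[of "f x y"])
    also have "\<dots> = (f x y \<otimes> t (x \<otimes> y)) \<otimes> t z"
      using c by (simp add: m_assoc[of "f x y"] ft[of "x \<otimes> y" z])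
    also have "\<dots> = t x \<otimes> (t y \<otimes> t z)"
      using c by (simp add: ft[OF c(1,2), symmetric] m_assoc[of "t x"])
    also have "\<dots> = (t x \<otimes> f y z) \<otimes> t (y \<otimes> z)"
      using c by (simp add: m_assoc[of "t x"] ft[OF c(2,3)])
    also have "\<dots> = j (t x) (f y z) \<otimes> (t x \<otimes> t (y \<otimes> z))"
      using c by (simp add: jg[of "t x" "f y z", symmetric] m_assoc[of "j (t x) (f y z)"])
    also have "\<dots> = j (t x) (f y z) \<otimes> f x (y \<otimes> z) \<otimes> t (x \<otimes> y \<otimes> z)"
      using c by (simp add: ft[of x "y \<otimes> z"] m_assoc)
    finally show ?thesis
      using c by (simp add: right_cancel)
  qed
  define c where "c x = finprod K (f x) T" for x
  define m where "m = card (rcosets H)"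
  have cH[simp]: "c x \<in> H" if "x \<in> carrier G" for x
    proof -
    have "f x \<in> T \<rightarrow> H" using that Tc fH by blast
    then show ?thesis unfolding c_def using K.finprod_closed[of "f x" T] by simp
  qed
  have cc[simp]: "c x \<in> carrier G" if "x \<in> carrier G" for x
    using that cH subset by blast
  have jprod: "finprod K (\<lambda>z. j g (F z)) A = j g (finprod K F A)"
    if "g \<in> carrier G" "F \<in> A \<rightarrow> H" "finite A" for g F A
    using that(3,2)
  proof (induction A)
    case empty then show ?case using that(1) by (simp add: j_def)
  next
    case (insert a A)
    then have "finprod K F A \<in> H"
      using K.finprod_closed[of F A] by auto
    with insert show ?case using that(1) by (auto simp: jm Pi_iff)
  qed
  have cmul: "f x y [^] m \<otimes> c (x \<otimes> y) = j (t x) (c y) \<otimes> c x"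
    if xy: "x \<in> carrier G" "y \<in> carrier G" for x y
  proof -
    have "f x y [^] m \<otimes> c (x \<otimes> y) = finprod K (\<lambda>z. f x y \<otimes> f (x \<otimes> y) z) T"
      unfolding c_def m_def cT[symmetric] using xy Tc
      by (subst K.finprod_multf[simplified]) (auto simp: K.finprod_const[simplified])
    also have "\<dots> = finprod K (\<lambda>z. j (t x) (f y z) \<otimes> f x (y \<otimes> z)) T"
      using xy Tc by (intro K.finprod_cong') (auto simp: cocycle)
    also have "\<dots> = finprod K (\<lambda>z. j (t x) (f y z)) T \<otimes> finprod K (\<lambda>z. f x (y \<otimes> z)) T"
      using xy Tc by (intro K.finprod_multf[simplified]) auto
    also have "finprod K (\<lambda>z. j (t x) (f y z)) T = j (t x) (c y)"
      unfolding c_def using xy Tc finT by (intro jprod) auto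
    \<comment> \<open>The value of \<open>f x\<close> depends only on the coset of its second
      argument, and \<open>z \<mapsto> t (y \<otimes> z)\<close> permutes the transversal
      \<open>T\<close>, so the product is merely reindexed.\<close>
    also have "finprod K (\<lambda>z. f x (y \<otimes> z)) T = c x"
    proof -
      define b where "b z = t (y \<otimes> z)" for z
      have inj: "inj_on b T"
      proof (rule inj_onI)
        fix z z' assume z: "z \<in> T" "z' \<in> T" "b z = b z'"
        have zc: "z \<in> carrier G" "z' \<in> carrier G" using z Tc by auto
        have "H #> (y \<otimes> z) = H #> (y \<otimes> z')"
          using tH[of "y \<otimes> z"] tH[of "y \<otimes> z'"] z zc xy unfolding b_def by simp
        then have "H #> (inv y \<otimes> (y \<otimes> z)) = H #> (inv y \<otimes> (y \<otimes> z'))"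
          by (rule rcos_mult_cong[OF refl]) (use zc xy in auto)
        then show "z = z'"
          using zc xy teq tT z by (metis inv_closed l_inv l_one m_assoc)
      qed
      have bT: "b ` T \<subseteq> T" using xy Tc by (auto simp: b_def T_def)
      have img: "b ` T = T" using endo_inj_surj[OF finT bT inj] .
      have bc: "b z \<in> carrier G" if "z \<in> T" for z using that bT Tc by blast
      have "finprod K (f x) (b ` T) = finprod K (\<lambda>z. f x (b z)) T"
        using xy bc inj by (intro K.finprod_reindex) auto
      moreover have "f x (b z) = f x (y \<otimes> z)" if "z \<in> T" for z
      proof -
        have z: "z \<in> carrier G" using that Tc by auto
        have "t (t (y \<otimes> z)) = t (y \<otimes> z)" using z xy by (intro teq tH) auto
        moreover have "t (x \<otimes> t (y \<otimes> z)) = t (x \<otimes> (y \<otimes> z))"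
          using z xy by (intro teq rcos_mult_cong[of x x]) (auto simp: tH)
        ultimately show ?thesis by (simp add: f_def b_def)
      qed
      ultimately show ?thesis
        unfolding c_def img using xy Tc by (auto intro!: K.finprod_cong')
    qed
    finally show ?thesis .
  qed
  \<comment> \<open>The exponent \<open>n\<close> is minus the inverse of \<open>m\<close> modulo
    \<open>card H\<close>. This sign makes \<open>f x y [^] (n * m + 1)\<close> trivial.\<close>
  have "\<exists>n k. n * m + 1 = k * card H"
  proof -
    have "card H \<noteq> 0" using finite_imp_card_positive[OF fin] by simp
    then obtain k n where "card H * k = m * n + gcd (card H) m" using bezout_nat by blast
    moreover have "gcd (card H) m = 1" using cop by (simp add: m_def)
    ultimately show ?thesis by (metis mult.commute)
  qed
  then obtain n k where nk: "n * m + 1 = k * card H" by blast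
  have powH: "a [^] card H = \<one>" if "a \<in> H" for a
    using K.power_order_eq_one[of a] that finH by simp
  \<comment> \<open>The \<open>n\<close>-th power of \<open>cmul\<close> contributes
    \<open>f x y [^] (n * m)\<close>, and moving from \<open>t x \<otimes> t y\<close> to
    \<open>t (x \<otimes> y)\<close> contributes one more factor \<open>f x y\<close>; together they
    vanish, so \<open>s\<close> is multiplicative.\<close>
  define s where "s x = c x [^] n \<otimes> t x" for x
  have sc[simp]: "s x \<in> carrier G" if "x \<in> carrier G" for x
    using that by (simp add: s_def)
  have smul: "s (x \<otimes> y) = s x \<otimes> s y" if xy: "x \<in> carrier G" "y \<in> carrier G" for x y
  proof -
    have jpow: "j g (a [^] i) = j g a [^] i" if "g \<in> carrier G" "a \<in> carrier G" for g a and i :: nat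
      using that by (induction i) (auto simp: jm, simp add: j_def)
    have "s x \<otimes> s y = c x [^] n \<otimes> (t x \<otimes> c y [^] n) \<otimes> t y"
      using xy by (simp add: s_def m_assoc)
    also have "\<dots> = c x [^] n \<otimes> j (t x) (c y) [^] n \<otimes> (t x \<otimes> t y)"
      using xy by (simp add: jg[of "t x" "c y [^] n", symmetric] jpow m_assoc)
    also have "c x [^] n \<otimes> j (t x) (c y) [^] n = (j (t x) (c y) \<otimes> c x) [^] n"
      using xy comm pow_mult_distrib[of "c x" "j (t x) (c y)" n] by simp
    also have "\<dots> = (f x y [^] m \<otimes> c (x \<otimes> y)) [^] n"
      using xy by (simp add: cmul)
    also have "\<dots> = f x y [^] (n * m) \<otimes> c (x \<otimes> y) [^] n"
      using xy K.nat_pow_distrib[of "f x y [^] m" "c (x \<otimes> y)" n] K.nat_pow_closed[of "f x y" m]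
      by (simp add: nat_pow_pow mult.commute)
    also have "\<dots> \<otimes> (t x \<otimes> t y) = f x y [^] (n * m) \<otimes> (c (x \<otimes> y) [^] n \<otimes> f x y) \<otimes> t (x \<otimes> y)"
      using xy by (simp add: ft m_assoc)
    also have "c (x \<otimes> y) [^] n \<otimes> f x y = f x y \<otimes> c (x \<otimes> y) [^] n"
      using xy comm K.nat_pow_closed[of "c (x \<otimes> y)" n] by simp
    also have "f x y [^] (n * m) \<otimes> (f x y \<otimes> c (x \<otimes> y) [^] n) = f x y [^] (n * m + 1) \<otimes> c (x \<otimes> y) [^] n"
      using xy by (simp add: m_assoc)
    also have "f x y [^] (n * m + 1) = \<one>"
      unfolding nk using xy nat_pow_pow[of "f x y" "card H" k] powH[of "f x y"]
      by (simp add: mult.commute)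
    finally show ?thesis using xy by (simp add: s_def)
  qed
  have hom: "s \<in> hom G G" by (intro homI) (auto simp: smul)
  have sx: "s x \<otimes> inv x \<in> H" if x: "x \<in> carrier G" for x
  proof -
    have "t x \<otimes> inv x \<in> H" using x mult_inv_mem_iff[of "t x" x] by (simp add: tH)
    moreover have "c x [^] n \<in> H" using x K.nat_pow_closed[of "c x" n] by simp
    ultimately show ?thesis using x by (simp add: s_def m_assoc)
  qed
  have one: "s \<one> = \<one>"
    using smul[of \<one> \<one>] by simp
  have "kernel G G s = H"
  proof (intro equalityI subsetI)
    fix x assume x: "x \<in> kernel G G s"
    then have "inv x \<in> H" using sx[of x] by (simp add: kernel_def)
    then have "inv (inv x) \<in> H" by (rule m_inv_closed)
    then show "x \<in> H" using x by (simp add: kernel_def)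
  next
    \<comment> \<open>Both \<open>t\<close> and \<open>c\<close> are constant on cosets of
      \<open>H\<close>, hence so is \<open>s\<close>, and \<open>x\<close> lies in the coset of
      \<open>\<one>\<close>.\<close>
    fix x assume x: "x \<in> H"
    then have e: "H #> x = H #> \<one>"
      using coset_join2[OF _ subgroup_axioms] by simp
    have xc: "x \<in> carrier G" using x by simp
    have "t x = t \<one>" using e teq by blast
    moreover have "f x z = f \<one> z" if z: "z \<in> carrier G" for z
    proof -
      have "t (x \<otimes> z) = t (\<one> \<otimes> z)"
        using e xc z by (intro teq rcos_mult_cong[of x \<one> z z]) auto
      then show ?thesis using \<open>t x = t \<one>\<close> by (simp add: f_def)
    qed
    then have "c x = c \<one>" unfolding c_def using Tc xc
      by (intro K.finprod_cong') auto
    ultimately have "s x = s \<one>" by (simp add: s_def)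
    then show "x \<in> kernel G G s" using xc one by (simp add: kernel_def)
  qed
  with hom sx show ?thesis using that by blast
qed

text \<open>The complement is the image of the endomorphism \<open>s\<close> with kernel
  \<open>H\<close>. Its order comes from the isomorphism theorem, and
  \<open>s x \<otimes> inv x \<in> H\<close> yields the factorization of each
  \<open>x\<close>.\<close>

lemma (in normal) abelian_normal_complement:
  assumes fin: "finite (carrier G)"
    and comm: "\<And>a b. a \<in> H \<Longrightarrow> b \<in> H \<Longrightarrow> a \<otimes> b = b \<otimes> a"
    and cop: "coprime (card H) (card (rcosets H))"
  obtains A where "subgroup A G" "card A * card H = order G"
    "\<And>x. x \<in> carrier G \<Longrightarrow> \<exists>h\<in>H. \<exists>a\<in>A. x = h \<otimes> a"
proof -
  obtain s where s: "s \<in> hom G G" "kernel G G s = H" "\<And>x. x \<in> carrier G \<Longrightarrow> s x \<otimes> inv x \<in> H"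
    using abelian_normal_complement_hom[OF fin comm cop] by blast
  interpret s: group_hom G G s using s(1) by unfold_locales
  have "x = inv (s x \<otimes> inv x) \<otimes> s x" if "x \<in> carrier G" for x
    using that by (simp add: inv_mult_group m_assoc)
  then have "\<exists>h\<in>H. \<exists>a\<in>s ` carrier G. x = h \<otimes> a" if "x \<in> carrier G" for x
    using that s(3) m_inv_closed by blast
  then show ?thesis
    using that s.img_is_subgroup s.card_image_times_card_kernel s(2) by blast
qed

section \<open>Normal Hall subgroups as solution sets of power equations\<close>

lemma (in group) conjugate_pow:
  assumes "g \<in> carrier G" "x \<in> carrier G"
  shows "(g \<otimes> x \<otimes> inv g) [^] (n::nat) = g \<otimes> x [^] n \<otimes> inv g"
proof (induction n)
  case (Suc n)
  have "(g \<otimes> x [^] n \<otimes> inv g) \<otimes> (g \<otimes> x \<otimes> inv g) = g \<otimes> x [^] n \<otimes> (inv g \<otimes> g) \<otimes> x \<otimes> inv g"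
    using assms by (simp only: m_assoc m_closed inv_closed nat_pow_closed)
  then show ?case using Suc assms by (simp add: m_assoc)
qed (use assms in simp)

text \<open>If \<open>x [^] card H = \<one>\<close>, the order of the coset of \<open>x\<close>
  divides both \<open>card H\<close> and the index, so the coset is trivial. Since conjugation
  preserves a power equation, this description lets normality pass from a normal subgroup to the
  whole group.\<close>

lemma (in normal) coprime_index_imp_eq:
  assumes cop: "coprime (card H) (card (rcosets H))"
  shows "H = {x \<in> carrier G. x [^] card H = \<one>}"
proof (intro equalityI subsetI CollectI conjI)
  fix x assume x: "x \<in> H"
  then show "x \<in> carrier G" by simp
  interpret S: group "G\<lparr>carrier := H\<rparr>" by (rule subgroup_is_group) (rule is_group)
  show "x [^] card H = \<one>"
    using S.pow_order_eq_1[of x] x by (simp add: order_def nat_pow_consistent[symmetric])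
next
  fix x assume "x \<in> {x \<in> carrier G. x [^] card H = \<one>}"
  then have x: "x \<in> carrier G" "x [^] card H = \<one>" by auto
  interpret Q: group "G Mod H" by (rule factorgroup_is_group)
  have c: "H #> x \<in> carrier (G Mod H)" using x by (auto simp: carrier_FactGroup)
  have "(H #> x) [^]\<^bsub>G Mod H\<^esub> card H = \<one>\<^bsub>G Mod H\<^esub>"
    using x FactGroup_pow[of x "card H"] coset_mult_one[OF subset] by simp
  then have "Q.ord (H #> x) dvd card H" using c Q.pow_eq_id by blast
  moreover have "Q.ord (H #> x) dvd card (rcosets H)"
    using Q.ord_dvd_group_order[OF c] by (simp add: order_def FactGroup_def)
  ultimately have "Q.ord (H #> x) = 1" using cop coprime_common_divisor_nat by blast
  then have "H #> x = H" using Q.ord_eq_1[OF c] by simp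
  then show "x \<in> H" using coset_join1[OF _ _ subgroup_axioms] subset x by blast
qed

text \<open>Inductions on the group order have to stay within one type, whereas the elements of
  \<open>G Mod N\<close> are sets; this replaces the quotient by an isomorphic group on representatives.\<close>

lemma (in normal) quotient_same_type:
  assumes fin: "finite (carrier G)"
  obtains h and G' :: "('a, 'b) monoid_scheme"
  where "group_hom G G' h" "h ` carrier G = carrier G'" "kernel G G' h = H"
    "finite (carrier G')" "order G' * card H = order G"
proof -
  obtain t where tc[simp]: "\<And>x. x \<in> carrier G \<Longrightarrow> t x \<in> carrier G"
    and tH: "\<And>x. x \<in> carrier G \<Longrightarrow> H #> t x = H #> x"
    and teq: "\<And>x y. H #> x = H #> y \<Longrightarrow> t x = t y"
    using coset_representatives by blast
  define G' where "G' = G\<lparr>carrier := t ` carrier G, monoid.mult := \<lambda>x y. t (x \<otimes> y), one := t \<one>\<rparr>"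
  have tm: "t (t x \<otimes> t y) = t (x \<otimes> y)" if "x \<in> carrier G" "y \<in> carrier G" for x y
    using that tH by (intro teq rcos_mult_cong) auto
  have tm1: "t (t x \<otimes> y) = t (x \<otimes> y)" if "x \<in> carrier G" "y \<in> carrier G" for x y
    using that tH by (intro teq rcos_mult_cong[of "t x" x y y]) auto
  have tm2: "t (x \<otimes> t y) = t (x \<otimes> y)" if "x \<in> carrier G" "y \<in> carrier G" for x y
    using that tH by (intro teq rcos_mult_cong[of x x "t y" y]) auto
  have grp: "group G'"
  proof (rule groupI)
    fix x assume "x \<in> carrier G'"
    then obtain a where a: "a \<in> carrier G" "x = t a" by (auto simp: G'_def)
    then have "t (inv a) \<in> carrier G'" "t (inv a) \<otimes>\<^bsub>G'\<^esub> x = \<one>\<^bsub>G'\<^esub>"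
      by (auto simp: G'_def tm)
    then show "\<exists>y\<in>carrier G'. y \<otimes>\<^bsub>G'\<^esub> x = \<one>\<^bsub>G'\<^esub>" by blast
  qed (auto simp: G'_def tm1 tm2 m_assoc)
  have hom: "group_hom G G' t"
    by (intro group_hom.intro group_hom_axioms.intro is_group grp) (auto simp: G'_def tm hom_def)
  have "kernel G G' t = H"
  proof (intro equalityI subsetI)
    fix x assume "x \<in> kernel G G' t"
    then have x: "x \<in> carrier G" "t x = t \<one>" by (auto simp: kernel_def G'_def)
    then have "H #> x = H #> \<one>" using tH[of x] tH[of \<one>] by simp
    then show "x \<in> H"
      using coset_join1[OF _ x(1) subgroup_axioms] subset by simp
  next
    fix x assume x: "x \<in> H"
    then have "H #> x = H #> \<one>"
      using coset_join2[OF _ subgroup_axioms] by simp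
    then have "t x = t \<one>" by (rule teq)
    then show "x \<in> kernel G G' t" using x by (simp add: kernel_def G'_def)
  qed
  moreover have "t ` carrier G = carrier G'" by (simp add: G'_def)
  moreover have "finite (carrier G')" using fin by (simp add: G'_def)
  moreover have "order G' * card H = order G"
    using group_hom.card_image_times_card_kernel[OF hom] calculation by (simp add: order_def)
  ultimately show ?thesis using that hom by blast
qed

section \<open>Preimages of subgroups under homomorphisms\<close>

lemma (in group_hom) subgroup_preimage:
  assumes "subgroup K H"
  shows "subgroup {x \<in> carrier G. h x \<in> K} G"
proof -
  interpret K: subgroup K H by fact
  show ?thesis by (rule G.subgroupI) (auto intro: exI[of _ \<one>])
qed

lemma (in group_hom) normal_preimage:
  assumes "K \<lhd> H"
  shows "{x \<in> carrier G. h x \<in> K} \<lhd> G"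
proof -
  interpret K: normal K H by fact
  show ?thesis
    by (rule G.normal_invI[OF subgroup_preimage[OF K.subgroup_axioms]])
       (auto simp: K.inv_op_closed2)
qed

lemma (in group_hom) card_preimage:
  assumes "subgroup K H" "K \<subseteq> h ` carrier G"
  shows "card {x \<in> carrier G. h x \<in> K} = card K * card (kernel G H h)"
proof -
  interpret K: subgroup K H by fact
  let ?P = "{x \<in> carrier G. h x \<in> K}"
  interpret P: group_hom "G\<lparr>carrier := ?P\<rparr>" H h
    using G.subgroup_imp_group[OF subgroup_preimage[OF assms(1)]] H.is_group
    by (intro group_hom.intro group_hom_axioms.intro) (auto intro!: homI)
  have "kernel (G\<lparr>carrier := ?P\<rparr>) H h = kernel G H h" by (auto simp: kernel_def)
  moreover have "h ` ?P = K" using assms(2) by auto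
  ultimately show ?thesis
    using P.card_image_times_card_kernel by (simp add: order_def)
qed

section \<open>Nilpotent groups\<close>

lemma (in group_hom) commutator_subgroup_img:
  assumes "A \<subseteq> carrier G" "B \<subseteq> carrier G"
  shows "h ` commutator_subgroup G A B = commutator_subgroup H (h ` A) (h ` B)"
proof -
  let ?C = "{a \<otimes> b \<otimes> inv a \<otimes> inv b |a b. a \<in> A \<and> b \<in> B}"
  have "h (a \<otimes> b \<otimes> inv a \<otimes> inv b) = h a \<otimes>\<^bsub>H\<^esub> h b \<otimes>\<^bsub>H\<^esub> inv\<^bsub>H\<^esub> h a \<otimes>\<^bsub>H\<^esub> inv\<^bsub>H\<^esub> h b"
    if "a \<in> A" "b \<in> B" for a b
    using that assms by (simp add: subsetD)
  then have "h ` ?C = {a \<otimes>\<^bsub>H\<^esub> b \<otimes>\<^bsub>H\<^esub> inv\<^bsub>H\<^esub> a \<otimes>\<^bsub>H\<^esub> inv\<^bsub>H\<^esub> b |a b. a \<in> h ` A \<and> b \<in> h ` B}"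
    by (auto simp: image_iff) metis+
  moreover have "?C \<subseteq> carrier G" using assms by (auto simp: subsetD)
  ultimately show ?thesis
    unfolding commutator_subgroup_def using generate_img[of ?C] by simp
qed

lemma (in group) commutator_subgroup_normal:
  assumes "N \<lhd> G"
  shows "commutator_subgroup G N (carrier G) \<lhd> G"
proof -
  interpret N: normal N G by fact
  show ?thesis
    unfolding commutator_subgroup_def
  proof (rule normal_generateI)
    show "{a \<otimes> b \<otimes> inv a \<otimes> inv b |a b. a \<in> N \<and> b \<in> carrier G} \<subseteq> carrier G" by auto
  next
    fix h g assume g: "g \<in> carrier G"
      and "h \<in> {a \<otimes> b \<otimes> inv a \<otimes> inv b |a b. a \<in> N \<and> b \<in> carrier G}"
    then obtain a b where ab: "h = a \<otimes> b \<otimes> inv a \<otimes> inv b" "a \<in> N" "b \<in> carrier G" by blast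
    have a: "a \<in> carrier G" using ab by simp
    have c: "g \<otimes> (x \<otimes> y) \<otimes> inv g = (g \<otimes> x \<otimes> inv g) \<otimes> (g \<otimes> y \<otimes> inv g)"
      if "x \<in> carrier G" "y \<in> carrier G" for x y
      using that g by (simp add: inv_solve_left m_assoc)
    have i: "g \<otimes> inv x \<otimes> inv g = inv (g \<otimes> x \<otimes> inv g)" if "x \<in> carrier G" for x
      using that g by (simp add: inv_mult_group m_assoc)
    have "g \<otimes> h \<otimes> inv g = (g \<otimes> a \<otimes> inv g) \<otimes> (g \<otimes> b \<otimes> inv g) \<otimes> inv (g \<otimes> a \<otimes> inv g) \<otimes> inv (g \<otimes> b \<otimes> inv g)"
      unfolding ab(1) using a ab(3) by (simp only: c i m_closed inv_closed)
    moreover have "g \<otimes> a \<otimes> inv g \<in> N" "g \<otimes> b \<otimes> inv g \<in> carrier G"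
      using ab g N.inv_op_closed2 by auto
    ultimately show "g \<otimes> h \<otimes> inv g \<in> {a \<otimes> b \<otimes> inv a \<otimes> inv b |a b. a \<in> N \<and> b \<in> carrier G}"
      by blast
  qed
qed

lemma (in group) commutator_subgroup_subset:
  assumes "N \<lhd> G"
  shows "commutator_subgroup G N (carrier G) \<subseteq> N"
proof -
  interpret N: normal N G by fact
  have "a \<otimes> b \<otimes> inv a \<otimes> inv b \<in> N" if ab: "a \<in> N" "b \<in> carrier G" for a b
  proof -
    have "a \<otimes> (b \<otimes> inv a \<otimes> inv b) \<in> N" using ab N.inv_op_closed2[of b "inv a"] by simp
    then show ?thesis using ab by (simp add: m_assoc)
  qed
  then show ?thesis
    unfolding commutator_subgroup_def by (intro generate_subgroup_incl N.subgroup_axioms) blast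
qed

lemma lower_central_0 [simp]: "lower_central G 0 = carrier G"
  by (simp add: lower_central_def)

lemma lower_central_Suc [simp]:
  "lower_central G (Suc n) = commutator_subgroup G (lower_central G n) (carrier G)"
  by (simp add: lower_central_def)

lemma (in group) lower_central_normal: "lower_central G n \<lhd> G"
  by (induction n) (auto intro: normal_self commutator_subgroup_normal)

lemma (in group) lower_central_antimono:
  assumes "m \<le> n"
  shows "lower_central G n \<subseteq> lower_central G m"
  using commutator_subgroup_subset[OF lower_central_normal]
  by (intro lift_Suc_antimono_le[OF _ assms]) simp

lemma (in group_hom) lower_central_img:
  assumes "h ` carrier G = carrier H"
  shows "h ` lower_central G n = lower_central H n"
proof (induction n)
  case (Suc n)
  have "lower_central G n \<subseteq> carrier G"
    using G.lower_central_antimono[of 0 n] by simp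
  then show ?case using Suc commutator_subgroup_img[of "lower_central G n" "carrier G"] assms by simp
qed (use assms in simp)

text \<open>A surjection maps each lower central term onto the corresponding one, so a term of the
  image is trivial exactly when the term upstairs lies in the kernel.\<close>

lemma (in group_hom) nilpotent_img_iff:
  assumes "h ` carrier G = carrier H"
  shows "nilpotent H \<longleftrightarrow> (\<exists>n. lower_central G n \<subseteq> kernel G H h)"
proof -
  have "lower_central H n = {\<one>\<^bsub>H\<^esub>} \<longleftrightarrow> lower_central G n \<subseteq> kernel G H h" for n
  proof -
    have "\<one> \<in> lower_central G n" "lower_central G n \<subseteq> carrier G"
      using G.lower_central_normal[of n, THEN normal_imp_subgroup] subgroup.one_closed subgroup.subset
      by blast+
    then show ?thesis
      unfolding lower_central_img[OF assms, symmetric] kernel_def by auto force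
  qed
  then show ?thesis by (simp add: nilpotent_def H.is_group)
qed

lemma (in group_hom) nilpotent_img:
  assumes "h ` carrier G = carrier H" "nilpotent G"
  shows "nilpotent H"
proof -
  obtain n where "lower_central G n = {\<one>}" using assms(2) by (auto simp: nilpotent_def)
  then have "lower_central G n \<subseteq> kernel G H h" by (simp add: kernel_def)
  then show ?thesis using nilpotent_img_iff[OF assms(1)] by blast
qed

lemma (in normal) group_hom_Mod: "group_hom G (G Mod H) (\<lambda>x. H #> x)"
  using r_coset_hom_Mod factorgroup_is_group
  by (simp add: group_hom.intro group_hom_axioms.intro is_group)

lemma (in normal) kernel_Mod: "kernel G (G Mod H) (\<lambda>x. H #> x) = H"
  using coset_join1[OF _ _ subgroup_axioms] coset_join2[OF _ subgroup_axioms] subset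
  by (auto simp: kernel_def)

lemma (in normal) nilpotent_Mod_iff: "nilpotent (G Mod H) \<longleftrightarrow> (\<exists>n. lower_central G n \<subseteq> H)"
  using group_hom.nilpotent_img_iff[OF group_hom_Mod]
  by (simp add: kernel_Mod carrier_FactGroup)

section \<open>The nilpotent residual of a finite group\<close>

text \<open>The descending series is constant from a term of least order on. That term has a
  nilpotent quotient and lies in every normal subgroup with nilpotent quotient, so the intersection
  defining the residual is attained.\<close>

lemma (in group) nilpotent_residual_eq_lower_central:
  assumes "finite (carrier G)"
  obtains n where "nilpotent_residual G = lower_central G n"
proof -
  obtain n where n: "\<And>m. card (lower_central G n) \<le> card (lower_central G m)"
    using ex_has_least_nat[of "\<lambda>_. True" _ "\<lambda>n. card (lower_central G n)"] by blast
  have "finite (lower_central G m)" for m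
    using assms lower_central_antimono[of 0 m] finite_subset by auto
  then have stable: "lower_central G m = lower_central G n" if "n \<le> m" for m
    using card_seteq[OF _ lower_central_antimono[OF that]] n by blast
  have "lower_central G n \<subseteq> N" if N: "N \<lhd> G" "nilpotent (G Mod N)" for N
  proof -
    obtain m where "lower_central G m \<subseteq> N" using N normal.nilpotent_Mod_iff by blast
    moreover have "lower_central G n \<subseteq> lower_central G m"
      using stable[of "max m n"] lower_central_antimono[of m "max m n"] by simp
    ultimately show ?thesis by blast
  qed
  moreover have "nilpotent (G Mod lower_central G n)"
    using normal.nilpotent_Mod_iff[OF lower_central_normal] by blast
  ultimately have "nilpotent_residual G = lower_central G n"
    unfolding nilpotent_residual_def using lower_central_normal by blast
  then show ?thesis by (rule that)
qed

lemma (in group) nilpotent_residual_normal: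
  assumes "finite (carrier G)"
  shows "nilpotent_residual G \<lhd> G"
  by (rule nilpotent_residual_eq_lower_central[OF assms]) (simp add: lower_central_normal)

lemma (in group) nilpotent_Mod_nilpotent_residual:
  assumes "finite (carrier G)"
  shows "nilpotent (G Mod nilpotent_residual G)"
proof -
  obtain n where "nilpotent_residual G = lower_central G n"
    by (rule nilpotent_residual_eq_lower_central[OF assms])
  then show ?thesis
    using normal.nilpotent_Mod_iff[OF nilpotent_residual_normal[OF assms]] by blast
qed

text \<open>The derived subgroup is the lower central term of index 1, so the quotient by it is
  nilpotent.\<close>

lemma (in group) nilpotent_residual_subset_derived:
  "nilpotent_residual G \<subseteq> derived G (carrier G)"
proof -
  have "lower_central G (Suc 0) = derived G (carrier G)"
    unfolding lower_central_Suc lower_central_0 commutator_subgroup_def derived_def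
    by (rule arg_cong[of _ _ "generate G"]) blast
  then have "nilpotent (G Mod derived G (carrier G))"
    using normal.nilpotent_Mod_iff[OF derived_self_is_normal] by blast
  then show ?thesis
    unfolding nilpotent_residual_def using derived_self_is_normal by blast
qed

section \<open>Normal subgroups of nilpotent groups\<close>

text \<open>The last nontrivial term of the lower central series is central, because its commutators
  with the whole group form the trivial next term.\<close>

lemma (in group) nilpotent_imp_center_nontrivial:
  assumes "nilpotent G" "carrier G \<noteq> {\<one>}"
  obtains z where "z \<in> carrier G" "z \<noteq> \<one>" "\<And>x. x \<in> carrier G \<Longrightarrow> z \<otimes> x = x \<otimes> z"
proof -
  define n where "n = (LEAST n. lower_central G n = {\<one>})"
  have n: "lower_central G n = {\<one>}"
    unfolding n_def by (rule LeastI_ex) (use assms(1) nilpotent_def in blast)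
  then have "n \<noteq> 0" using assms(2) by (metis lower_central_0)
  then obtain m where m: "n = Suc m" using not0_implies_Suc by blast
  have "lower_central G m \<noteq> {\<one>}" using not_less_Least[of m "\<lambda>n. lower_central G n = {\<one>}"] m unfolding n_def by simp
  moreover have sub: "subgroup (lower_central G m) G"
    using lower_central_normal normal_imp_subgroup by blast
  ultimately obtain z where z: "z \<in> lower_central G m" "z \<noteq> \<one>"
    using subgroup.one_closed by blast
  have zc: "z \<in> carrier G" using z sub subgroup.mem_carrier by metis
  have "z \<otimes> x = x \<otimes> z" if x: "x \<in> carrier G" for x
  proof -
    have "z \<otimes> x \<otimes> inv z \<otimes> inv x \<in> lower_central G n"
      unfolding m lower_central_Suc commutator_subgroup_def
      using z x by (intro generate.incl) blast
    then have "z \<otimes> x \<otimes> inv (x \<otimes> z) = \<one>" using n x zc by (simp add: inv_mult_group m_assoc)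
    then show ?thesis using x zc by (metis inv_closed inv_inv inv_equality m_closed)
  qed
  then show ?thesis using that z zc by blast
qed

lemma (in group) exists_power_of_prime_ord:
  assumes "finite (carrier G)" "x \<in> carrier G" "x \<noteq> \<one>"
  obtains k :: nat where "Factorial_Ring.prime (ord (x [^] k))"
proof -
  have "ord x \<noteq> 1" using assms ord_eq_1 by blast
  then obtain q where q: "Factorial_Ring.prime q" "q dvd ord x" using prime_factor_nat by blast
  have "ord x \<noteq> 0" using ord_ge_1[OF assms(1,2)] by simp
  moreover from this have "ord x div q \<noteq> 0" using q by (metis dvd_div_eq_0_iff)
  moreover have "ord x div q dvd ord x" using q(2) by (metis dvd_div_mult_self dvd_triv_left)
  ultimately have "ord (x [^] (ord x div q)) = q"
    using ord_pow[OF assms(2), of "ord x div q"] q by auto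
  then show ?thesis using that q by metis
qed

lemma (in group) generate_central:
  assumes "z \<in> carrier G" "\<And>x. x \<in> carrier G \<Longrightarrow> z \<otimes> x = x \<otimes> z"
    and "a \<in> generate G {z}" "x \<in> carrier G"
  shows "a \<otimes> x = x \<otimes> a"
  using assms(3)
proof induction
  case (inv h)
  then show ?case
    using assms by (metis inv_closed inv_mult_group inv_inv singletonD)
next
  case (eng h1 h2)
  have "h1 \<in> carrier G" "h2 \<in> carrier G" using eng.hyps assms(1) generate_in_carrier[of "{z}"] by auto
  then show ?case using eng.IH assms(4) by (metis m_assoc)
qed (use assms in auto)

lemma (in group) generate_central_normal:
  assumes "z \<in> carrier G" "\<And>x. x \<in> carrier G \<Longrightarrow> z \<otimes> x = x \<otimes> z"
  shows "generate G {z} \<lhd> G"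
proof (rule normal_generateI)
  fix h g assume "h \<in> {z}" "g \<in> carrier G"
  then show "g \<otimes> h \<otimes> inv g \<in> {z}"
    using assms by (metis inv_solve_right m_closed singletonD singletonI)
qed (use assms in simp)

text \<open>Take a central subgroup \<open>Q\<close> of prime order \<open>q\<close> and apply
  \<open>IH\<close> to the quotient by \<open>Q\<close>. If \<open>q\<close> divides
  \<open>n\<close>, the preimage of a normal subgroup of order \<open>n div q\<close> works.
  Otherwise the preimage \<open>P\<close> of one of order \<open>n\<close> has order
  \<open>n * q\<close>, and a complement \<open>A\<close> of \<open>Q\<close> in \<open>P\<close> is
  the set of solutions of \<open>x [^] n = \<one>\<close> in \<open>P\<close>, hence normal in
  \<open>G\<close>. Having \<open>IH\<close> as an assumption lets the induction step run inside the
  locale of \<open>G\<close>.\<close>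

lemma (in group) nilpotent_normal_subgroup_of_order_step:
  assumes fin: "finite (carrier G)" and nilp: "nilpotent G" and n: "n dvd order G"
    and IH: "\<And>(G' :: ('a, 'b) monoid_scheme) m. order G' < order G \<Longrightarrow> group G' \<Longrightarrow>
      finite (carrier G') \<Longrightarrow> nilpotent G' \<Longrightarrow> m dvd order G' \<Longrightarrow> \<exists>N. N \<lhd> G' \<and> card N = m"
  shows "\<exists>N. N \<lhd> G \<and> card N = n"
proof -
  show ?thesis
  proof (cases "carrier G = {\<one>}")
    case True
    then have "n = 1" using n by (simp add: order_def)
    then show ?thesis using one_is_normal by force
  next
    case False
    obtain z where z: "z \<in> carrier G" "z \<noteq> \<one>" "\<And>x. x \<in> carrier G \<Longrightarrow> z \<otimes> x = x \<otimes> z"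
      using nilpotent_imp_center_nontrivial[OF nilp False] by blast
    obtain k :: nat where k: "Factorial_Ring.prime (ord (z [^] k))"
      using exists_power_of_prime_ord[OF fin z(1,2)] by blast
    define q where "q = ord (z [^] k)"
    define Q where "Q = generate G {z [^] k}"
    have zk: "z [^] k \<in> carrier G" "\<And>x. x \<in> carrier G \<Longrightarrow> z [^] k \<otimes> x = x \<otimes> z [^] k"
      using z group_commutes_pow by auto
    have Qcent: "a \<otimes> x = x \<otimes> a" if "a \<in> Q" "x \<in> carrier G" for a x
      using generate_central[OF zk] that unfolding Q_def by blast
    interpret Q: normal Q G
      unfolding Q_def by (rule generate_central_normal[OF zk])
    have cQ: "card Q = q" unfolding Q_def q_def using generate_pow_card[OF zk(1)] by simp
    have q: "Factorial_Ring.prime q" using k q_def by simp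
    obtain h and G' :: "('a, 'b) monoid_scheme" where hG': "group_hom G G' h" "h ` carrier G = carrier G'"
      "kernel G G' h = Q" "finite (carrier G')" "order G' * card Q = order G"
      using Q.quotient_same_type[OF fin] by blast
    interpret h: group_hom G G' h by fact
    have nil: "nilpotent G'" using h.nilpotent_img hG'(2) nilp by blast
    have "order G > 0" using fin order_gt_0_iff_finite by blast
    then have "order G' > 0" using hG'(5) by (cases "order G'") auto
    then have "order G' * 1 < order G' * q" using prime_gt_1_nat[OF q] mult_less_mono2 by blast
    then have lt: "order G' < order G" unfolding hG'(5)[symmetric] cQ by (simp only: mult_1_right)
    have pre: "\<exists>P. P \<lhd> G \<and> Q \<subseteq> P \<and> card P = m * q" if m: "m dvd order G'" for m
    proof -
      obtain M where M: "M \<lhd> G'" "card M = m"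
        using IH[OF lt h.H.is_group hG'(4) nil m] by blast
      let ?P = "{x \<in> carrier G. h x \<in> M}"
      have sM: "subgroup M G'" using M normal_imp_subgroup by blast
      have "card ?P = m * q"
        using h.card_preimage[OF sM] subgroup.subset[OF sM] hG' M(2) cQ by simp
      moreover have "Q \<subseteq> ?P"
        using subgroup.one_closed[OF sM] unfolding hG'(3)[symmetric] by (auto simp: kernel_def)
      ultimately show ?thesis using h.normal_preimage[OF M(1)] by blast
    qed
    show ?thesis
    proof (cases "q dvd n")
      case True
      then obtain m where m: "n = m * q" by (metis dvd_def mult.commute)
      have "m dvd order G'" using n hG'(5) cQ m prime_gt_0_nat[OF q] by auto
      then show ?thesis using pre m by blast
    next
      case False
      then have cop: "coprime q n" using q prime_imp_coprime by blast
      have "n dvd order G' * q" using n hG'(5) cQ by simp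
      then have "n dvd order G'" using cop by (metis coprime_commute coprime_dvd_mult_left_iff)
      then obtain P where P: "P \<lhd> G" "Q \<subseteq> P" "card P = n * q" using pre by blast
      interpret P: normal P G by (rule P)
      let ?P = "G\<lparr>carrier := P\<rparr>"
      have finP: "finite P" using fin P.subset finite_subset by blast
      have nP: "Q \<lhd> ?P"
        using normal_restrict_supergroup[OF P.subgroup_axioms Q.normal_axioms P(2)] .
      then interpret QP: normal Q ?P .
      have idx: "card (rcosets\<^bsub>?P\<^esub> Q) = n"
        using QP.lagrange[OF QP.subgroup_axioms] P(3) cQ prime_gt_0_nat[OF q]
        by (simp add: order_def)
      obtain A where A: "subgroup A ?P" "card A * card Q = order ?P"
        "\<And>x. x \<in> carrier ?P \<Longrightarrow> \<exists>h\<in>Q. \<exists>a\<in>A. x = h \<otimes>\<^bsub>?P\<^esub> a"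
      proof (rule QP.abelian_normal_complement)
        show "finite (carrier ?P)" using finP by simp
        show "a \<otimes>\<^bsub>?P\<^esub> b = b \<otimes>\<^bsub>?P\<^esub> a" if "a \<in> Q" "b \<in> Q" for a b
          using Qcent that by simp
        show "coprime (card Q) (card (rcosets\<^bsub>?P\<^esub> Q))" using idx cQ cop by simp
      qed blast
      have cA: "card A = n" using A(2) P(3) cQ prime_gt_0_nat[OF q] by (simp add: order_def)
      have sA: "subgroup A G" using incl_subgroup[OF P.subgroup_axioms A(1)] .
      have AP: "A \<subseteq> P" using subgroup.subset[OF A(1)] by simp
      \<comment> \<open>Every element of \<open>P\<close> is \<open>g \<otimes> a\<close> with
        \<open>g \<in> Q\<close> central and \<open>a \<in> A\<close>, so it acts on
        \<open>A\<close> by conjugation as \<open>a\<close> does.\<close>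
      have nA: "A \<lhd> ?P"
      proof (rule QP.normal_invI[OF A(1)])
        fix x b assume x: "x \<in> carrier ?P" and b: "b \<in> A"
        then obtain g a where ga: "g \<in> Q" "a \<in> A" "x = g \<otimes> a" using A(3)[OF x] by auto
        have c: "g \<in> carrier G" "a \<in> carrier G" "b \<in> carrier G" "x \<in> carrier G"
          using ga b x AP P.subset by auto
        have "x \<otimes> b \<otimes> inv x = g \<otimes> (a \<otimes> b \<otimes> inv a) \<otimes> inv g"
          unfolding ga(3) using c by (simp add: inv_mult_group m_assoc)
        also have "\<dots> = a \<otimes> b \<otimes> inv a \<otimes> g \<otimes> inv g"
          using Qcent[OF ga(1), of "a \<otimes> b \<otimes> inv a"] c by simp
        also have "\<dots> = a \<otimes> b \<otimes> inv a" using c by (simp add: m_assoc)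
        also have "\<dots> \<in> A" using ga b sA by (simp add: subgroup.m_closed subgroup.m_inv_closed)
        finally show "x \<otimes>\<^bsub>?P\<^esub> b \<otimes>\<^bsub>?P\<^esub> inv\<^bsub>?P\<^esub> x \<in> A"
          using x P.subgroup_axioms by simp
      qed
      then interpret AP: normal A ?P .
      have "card (rcosets\<^bsub>?P\<^esub> A) * n = n * q"
        using QP.lagrange[OF AP.subgroup_axioms] P(3) cA by (simp add: order_def)
      moreover have "n > 0" using n \<open>order G > 0\<close> by (cases n) auto
      ultimately have "card (rcosets\<^bsub>?P\<^esub> A) = q" by simp
      then have "A = {x \<in> carrier ?P. x [^]\<^bsub>?P\<^esub> card A = \<one>\<^bsub>?P\<^esub>}"
        using cop cA by (intro AP.coprime_index_imp_eq) (simp add: coprime_commute)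
      then have Aeq: "A = {x \<in> P. x [^] n = \<one>}"
        by (simp add: cA nat_pow_consistent[symmetric])
      have "A \<lhd> G"
      proof (rule normal_invI[OF sA])
        fix x b assume "x \<in> carrier G" "b \<in> A"
        then show "x \<otimes> b \<otimes> inv x \<in> A"
          using P.inv_op_closed2 unfolding Aeq by (auto simp: conjugate_pow)
      qed
      then show ?thesis using cA by blast
    qed
  qed
qed

theorem nilpotent_normal_subgroup_of_order:
  fixes G :: "('a, 'b) monoid_scheme"
  assumes "group G" "finite (carrier G)" "nilpotent G" "n dvd order G"
  shows "\<exists>N. N \<lhd> G \<and> card N = n"
  using assms
proof (induction "order G" arbitrary: G n rule: less_induct)
  case (less G n)
  show ?case
    by (rule group.nilpotent_normal_subgroup_of_order_step[OF less.prems less.hyps])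
qed

section \<open>Groups of square-free order\<close>

text \<open>For square-free \<open>n\<close> this is the largest divisor of \<open>n\<close> all of
  whose prime divisors exceed \<open>t\<close>.\<close>

definition primes_above :: "nat \<Rightarrow> nat \<Rightarrow> nat" where
  "primes_above t n = \<Prod>{p. Factorial_Ring.prime p \<and> p dvd n \<and> t < p}"

lemma finite_prime_divisors_above: "n > 0 \<Longrightarrow> finite {p::nat. Factorial_Ring.prime p \<and> p dvd n \<and> t < p}"
  by (rule finite_subset[OF _ finite_divisors_nat[of n]]) auto

lemma primes_above_Suc:
  assumes "n > 0"
  shows "primes_above t n =
    (if Factorial_Ring.prime (Suc t) \<and> Suc t dvd n then Suc t else 1) * primes_above (Suc t) n"
proof -
  let ?A = "\<lambda>t. {p::nat. Factorial_Ring.prime p \<and> p dvd n \<and> t < p}"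
  have "?A t = (if Factorial_Ring.prime (Suc t) \<and> Suc t dvd n then insert (Suc t) (?A (Suc t)) else ?A (Suc t))"
    by (auto simp: Suc_lessI) (metis Suc_lessI)+
  then show ?thesis
    using finite_prime_divisors_above[OF assms, of "Suc t"] by (simp add: primes_above_def)
qed

lemma squarefree_nat_eq_prod_primes:
  fixes n :: nat
  assumes "squarefree n"
  shows "n = \<Prod>{p. Factorial_Ring.prime p \<and> p dvd n}"
proof -
  have n: "n > 0" using assms by (cases n) auto
  have "n = (\<Prod>p\<in>prime_factors n. p ^ multiplicity p n)"
    using n by (metis prime_factorization_nat)
  also have "\<dots> = (\<Prod>p\<in>prime_factors n. p)"
    using assms squarefree_factorial_semiring'[of n] n by (intro prod.cong) auto
  also have "prime_factors n = {p. Factorial_Ring.prime p \<and> p dvd n}"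
    using n by (auto simp: prime_factors_dvd)
  finally show ?thesis .
qed

lemma primes_above_0:
  assumes "squarefree n"
  shows "primes_above 0 n = n"
proof -
  have "{p. Factorial_Ring.prime p \<and> p dvd n \<and> 0 < p} = {p. Factorial_Ring.prime p \<and> p dvd n}"
    using prime_gt_0_nat by blast
  then show ?thesis
    using squarefree_nat_eq_prod_primes[OF assms] by (simp only: primes_above_def)
qed

lemma prod_distinct_primes_dvd:
  fixes n :: nat
  assumes "finite S" "\<And>p. p \<in> S \<Longrightarrow> Factorial_Ring.prime p \<and> p dvd n"
  shows "\<Prod>S dvd n"
  using assms
proof (induction S)
  case (insert p S)
  have "coprime p (\<Prod>S)"
    using insert by (intro prod_coprime_right primes_coprime) auto
  then show ?case using insert by (simp add: divides_mult)
qed simp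

text \<open>The primes above \<open>t\<close> that divide \<open>k * m\<close> but not
  \<open>m\<close> all divide \<open>k\<close>, hence so does their product. It is applied with an
  orbit length as \<open>k\<close> and a stabilizer order as \<open>m\<close>.\<close>

lemma primes_above_mult_dvd:
  assumes "m > 0" "k > 0"
  shows "primes_above t (k * m) dvd k * primes_above t m"
proof -
  let ?A = "\<lambda>n. {p::nat. Factorial_Ring.prime p \<and> p dvd n \<and> t < p}"
  have sub: "?A m \<subseteq> ?A (k * m)" by auto
  have fin: "finite (?A (k * m))" using assms by (intro finite_prime_divisors_above) simp
  have "primes_above t (k * m) = \<Prod>(?A (k * m) - ?A m) * primes_above t m"
    unfolding primes_above_def by (rule prod.subset_diff[OF sub fin])
  moreover have "\<Prod>(?A (k * m) - ?A m) dvd k"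
    using fin by (intro prod_distinct_primes_dvd) (auto simp: prime_dvd_mult_iff)
  ultimately show ?thesis by (simp add: mult_dvd_mono)
qed

lemma primes_above_cong:
  assumes "\<And>r. Factorial_Ring.prime r \<Longrightarrow> t < r \<Longrightarrow> r dvd m \<longleftrightarrow> r dvd n"
  shows "primes_above t m = primes_above t n"
  unfolding primes_above_def using assms by (intro arg_cong[of _ _ "\<Prod>"]) auto

lemma squarefree_prime_coprime_div:
  fixes p :: nat
  assumes "squarefree n" "n = k * p" "Factorial_Ring.prime p"
  shows "coprime p k"
proof (rule ccontr)
  assume "\<not> coprime p k"
  then have "p dvd k" using assms(3) prime_imp_coprime by blast
  then have "p\<^sup>2 dvd n" using assms(2) by (simp add: power2_eq_square)
  then have "is_unit p" using assms(1) squarefreeD by blast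
  then show False using assms(3) by simp
qed

section \<open>Elements whose order has only large prime divisors\<close>

text \<open>In a finite group of square-free order these are the solutions of
  \<open>x [^] primes_above t (order G) = \<one>\<close>, the set considered in Frobenius' theorem
  on power equations.\<close>

definition ord_primes_above :: "nat \<Rightarrow> ('a, 'b) monoid_scheme \<Rightarrow> 'a set" where
  "ord_primes_above t G =
    {x \<in> carrier G. \<forall>p. Factorial_Ring.prime p \<longrightarrow> p dvd group.ord G x \<longrightarrow> t < p}"

lemma (in group) ord_subgroup:
  assumes "subgroup H G"
  shows "group.ord (G\<lparr>carrier := H\<rparr>) x = ord x"
  using subgroup.subgroup_is_group[OF assms is_group]
  by (simp add: group.ord_def ord_def nat_pow_consistent[symmetric])

lemma (in group) ord_primes_above_subgroup:
  assumes "subgroup H G"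
  shows "ord_primes_above t (G\<lparr>carrier := H\<rparr>) = ord_primes_above t G \<inter> H"
  using subgroup.subset[OF assms] by (auto simp: ord_primes_above_def ord_subgroup[OF assms])

lemma (in group) ord_primes_above_Suc:
  "ord_primes_above t G - ord_primes_above (Suc t) G =
    {x \<in> ord_primes_above t G. Factorial_Ring.prime (Suc t) \<and> Suc t dvd ord x}"
proof (intro equalityI subsetI)
  fix x assume x: "x \<in> ord_primes_above t G - ord_primes_above (Suc t) G"
  then obtain p where p: "Factorial_Ring.prime p" "p dvd ord x" "\<not> Suc t < p"
    by (auto simp: ord_primes_above_def)
  then have "p = Suc t" using x by (auto simp: ord_primes_above_def Suc_lessI)
  then show "x \<in> {x \<in> ord_primes_above t G. Factorial_Ring.prime (Suc t) \<and> Suc t dvd ord x}"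
    using p x by simp
qed (auto simp: ord_primes_above_def)

lemma (in group) ord_primes_above_antimono:
  "ord_primes_above (Suc t) G \<subseteq> ord_primes_above t G"
  by (auto simp: ord_primes_above_def)

text \<open>Centrality makes \<open>P\<close> normal, square-freeness makes its index prime to
  \<open>p\<close>. In particular \<open>P\<close> contains every element of order
  \<open>p\<close>.\<close>

lemma (in group) central_prime_order_subgroup_eq:
  assumes p: "Factorial_Ring.prime p" and P: "subgroup P G" "card P = p"
    and cent: "\<And>z x. z \<in> P \<Longrightarrow> x \<in> carrier G \<Longrightarrow> z \<otimes> x = x \<otimes> z"
    and sq: "squarefree (order G)"
  shows "P = {x \<in> carrier G. x [^] p = \<one>}"
proof -
  interpret P: subgroup P G by (rule P)
  have nP: "P \<lhd> G"
  proof (rule normal_invI[OF P(1)])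
    fix x z assume "x \<in> carrier G" "z \<in> P"
    then have "x \<otimes> z \<otimes> inv x = z \<otimes> x \<otimes> inv x" using cent[of z x] by simp
    also have "\<dots> = z" using \<open>x \<in> carrier G\<close> \<open>z \<in> P\<close> by (simp add: m_assoc)
    finally have "x \<otimes> z \<otimes> inv x = z" .
    then show "x \<otimes> z \<otimes> inv x \<in> P" using \<open>z \<in> P\<close> by simp
  qed
  have "order G = card (rcosets P) * p" using lagrange[OF P(1)] P(2) by simp
  then have "coprime p (card (rcosets P))" using squarefree_prime_coprime_div[OF sq _ p] by blast
  then show ?thesis
    by (rule normal.coprime_index_imp_eq[OF nP, unfolded P(2)])
qed

text \<open>An element all of whose prime divisors of the order exceed \<open>t\<close> is uniquely
  a product of an element of \<open>P\<close> and one whose order has only primes above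
  \<open>p\<close>; multiplication is the bijection behind the factor \<open>p\<close>.\<close>

lemma (in group) card_ord_primes_above_central:
  assumes fin: "finite (carrier G)"
    and p: "Factorial_Ring.prime p" "p = Suc t"
    and P: "subgroup P G" "card P = p" and cent: "\<And>z x. z \<in> P \<Longrightarrow> x \<in> carrier G \<Longrightarrow> z \<otimes> x = x \<otimes> z"
    and sq: "squarefree (order G)"
  shows "card (ord_primes_above t G) = p * card (ord_primes_above (Suc t) G)"
proof -
  interpret P: subgroup P G by (rule P)
  define m where "m = card (rcosets P)"
  have mp: "order G = m * p" using lagrange[OF P(1)] P(2) m_def by simp
  have cop: "coprime p m" using squarefree_prime_coprime_div[OF sq mp p(1)] .
  have PE: "z \<in> P \<longleftrightarrow> z \<in> carrier G \<and> z [^] p = \<one>" for z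
    by (subst central_prime_order_subgroup_eq[OF p(1) P cent sq]) auto
  have ordm: "ord y dvd m" if y: "y \<in> carrier G" "\<not> p dvd ord y" for y
  proof -
    have "coprime (ord y) p" using y p(1) prime_imp_coprime coprime_commute by blast
    then show ?thesis
      using ord_dvd_group_order[OF y(1)] mp coprime_dvd_mult_left_iff[of "ord y" p m] by simp
  qed
  \<comment> \<open>The exponent \<open>m * k\<close> is congruent to 1 modulo \<open>p\<close> and
    divisible by \<open>m\<close>: the corresponding power fixes \<open>P\<close> pointwise and
    kills elements of order dividing \<open>m\<close>.\<close>
  obtain k j where kj: "m * k = p * j + 1"
  proof -
    have "gcd m p = 1" using cop by (simp add: coprime_commute)
    moreover have "m \<noteq> 0" using mp fin order_gt_0_iff_finite by (cases m) auto
    then obtain k j where "m * k = p * j + gcd m p" using bezout_nat by blast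
    ultimately have "m * k = p * j + 1" by simp
    then show ?thesis by (rule that)
  qed
  have zk: "z [^] (m * k) = z" if "z \<in> P" for z
  proof -
    have "z \<in> carrier G" "z [^] p = \<one>" using that PE by blast+
    then show ?thesis unfolding kj using nat_pow_pow[of z p j] by simp
  qed
  have "bij_betw (\<lambda>(z, y). z \<otimes> y) (P \<times> ord_primes_above (Suc t) G) (ord_primes_above t G)"
    unfolding bij_betw_def
  proof (intro conjI)
    have ym: "y \<in> carrier G" "y [^] m = \<one>" if "y \<in> ord_primes_above (Suc t) G" for y
      using that ordm[of y] p pow_eq_id[of y m] by (auto simp: ord_primes_above_def)
    show "inj_on (\<lambda>(z, y). z \<otimes> y) (P \<times> ord_primes_above (Suc t) G)"
    proof (rule inj_onI, clarify)
      fix z y z' y'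
      assume z: "z \<in> P" "z' \<in> P" and y: "y \<in> ord_primes_above (Suc t) G" "y' \<in> ord_primes_above (Suc t) G"
        and eq: "z \<otimes> y = z' \<otimes> y'"
      have "(z \<otimes> y) [^] m = z [^] m" if "z \<in> P" "y \<in> ord_primes_above (Suc t) G" for z y
        using that ym[OF that(2)] pow_mult_distrib[of z y m] cent by simp
      then have "z [^] m = z' [^] m" using z y eq by metis
      then have "z [^] (m * k) = z' [^] (m * k)" using z by (metis P.mem_carrier nat_pow_pow)
      then have "z = z'" using zk z by simp
      then show "z = z' \<and> y = y'" using eq z ym(1)[OF y(1)] ym(1)[OF y(2)] by simp
    qed
    show "(\<lambda>(z, y). z \<otimes> y) ` (P \<times> ord_primes_above (Suc t) G) = ord_primes_above t G"
    proof (intro equalityI subsetI)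
      fix x assume "x \<in> (\<lambda>(z, y). z \<otimes> y) ` (P \<times> ord_primes_above (Suc t) G)"
      then obtain z y where zy: "z \<in> P" "y \<in> ord_primes_above (Suc t) G" "x = z \<otimes> y" by auto
      have c: "z \<in> carrier G" "y \<in> carrier G" using zy ym by auto
      have "z [^] p = \<one>" using zy(1) PE by blast
      then have "ord z dvd p" using pow_eq_id c by blast
      moreover have "ord x dvd ord z * ord y"
        unfolding zy(3) using ord_mul_divides[of z y] cent zy c by blast
      ultimately have d: "ord x dvd p * ord y" by (meson dvd_refl dvd_trans mult_dvd_mono)
      have "t < r" if r: "Factorial_Ring.prime r" "r dvd ord x" for r
      proof -
        have "r dvd p \<or> r dvd ord y" using r d by (meson dvd_trans prime_dvd_mult_nat)
        then show ?thesis
        proof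
          assume "r dvd p"
          then have "r = p" using r p primes_dvd_imp_eq by blast
          then show ?thesis using p by simp
        next
          assume "r dvd ord y"
          then show ?thesis using zy(2) r(1) by (auto simp: ord_primes_above_def)
        qed
      qed
      then show "x \<in> ord_primes_above t G" using c zy(3) by (auto simp: ord_primes_above_def)
    next
      fix x assume x: "x \<in> ord_primes_above t G"
      then have xc: "x \<in> carrier G" by (simp add: ord_primes_above_def)
      \<comment> \<open>This power is the \<open>p\<close>-part of \<open>x\<close>; the remaining
        factor \<open>y\<close> satisfies \<open>y [^] m = \<one>\<close>, so \<open>p\<close> does
        not divide its order.\<close>
      define z where "z = x [^] (m * k)"
      define y where "y = inv z \<otimes> x"
      have "z [^] p = x [^] (order G * k)"
        using xc by (simp add: z_def nat_pow_pow mp mult_ac)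
      also have "\<dots> = \<one>" using xc pow_order_eq_1[OF xc] by (simp add: nat_pow_pow[symmetric])
      finally have zP: "z \<in> P" using xc by (simp add: PE z_def)
      have izP: "inv z \<in> P" using zP by simp
      have yc: "y \<in> carrier G" using xc zP by (simp add: y_def)
      have ypow: "y [^] n = inv (z [^] n) \<otimes> x [^] n" for n :: nat
        unfolding y_def using pow_mult_distrib[of "inv z" x n] cent[OF izP xc] xc zP
        by (simp add: nat_pow_inv)
      have "z [^] m = (x [^] m) [^] (m * k)"
        using xc by (simp add: z_def nat_pow_pow mult_ac)
      also have "\<dots> = (x [^] m) [^] (p * j) \<otimes> x [^] m" unfolding kj using xc by simp
      also have "(x [^] m) [^] (p * j) = (x [^] order G) [^] j"
        using xc by (simp add: nat_pow_pow mp mult_ac)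
      also have "\<dots> = \<one>" using pow_order_eq_1[OF xc] by simp
      finally have "z [^] m = x [^] m" using xc by simp
      then have "y [^] m = \<one>" using ypow[of m] xc by simp
      then have "ord y dvd m" using yc pow_eq_id by blast
      then have np: "\<not> p dvd ord y" using cop p(1)
        by (metis coprime_common_divisor dvd_refl dvd_trans not_prime_unit)
      have "z [^] ord x = (x [^] ord x) [^] (m * k)"
        using xc by (metis nat_pow_pow mult.commute z_def)
      then have "y [^] ord x = \<one>" using ypow[of "ord x"] xc by simp
      then have yx: "ord y dvd ord x" using yc pow_eq_id by blast
      have "Suc t < r" if r: "Factorial_Ring.prime r" "r dvd ord y" for r
      proof -
        have "t < r" using x r yx by (auto simp: ord_primes_above_def dest: dvd_trans)
        moreover have "r \<noteq> p" using r(2) np by blast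
        ultimately show ?thesis using p(2) by simp
      qed
      then have "y \<in> ord_primes_above (Suc t) G" using yc by (simp add: ord_primes_above_def)
      moreover have "x = z \<otimes> y" using xc zP by (simp add: y_def m_assoc[symmetric])
      ultimately show "x \<in> (\<lambda>(z, y). z \<otimes> y) ` (P \<times> ord_primes_above (Suc t) G)"
        using zP by (intro image_eqI[of _ _ "(z, y)"]) auto
    qed
  qed
  then have "card (P \<times> ord_primes_above (Suc t) G) = card (ord_primes_above t G)"
    by (rule bij_betw_same_card)
  then show ?thesis by (simp add: card_cartesian_product P(2))
qed

section \<open>Subgroups of prime order and their centralizers\<close>

lemma (in group) card_subgroup_dvd:
  assumes "subgroup A G" "subgroup B G" "A \<subseteq> B"
  shows "card A dvd card B"
proof -
  have "card (rcosets\<^bsub>G\<lparr>carrier := B\<rparr>\<^esub> A) * card A = card B"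
    using group.lagrange[OF subgroup_imp_group[OF assms(2)] subgroup_incl[OF assms]]
    by (simp add: order_def)
  then show ?thesis by (metis dvd_triv_right)
qed

lemma (in group) prime_order_subgroup_generate:
  assumes "subgroup P G" "Factorial_Ring.prime (card P)" "z \<in> P" "z \<noteq> \<one>"
  shows "P = generate G {z}" and "ord z = card P"
proof -
  have z: "z \<in> carrier G" using assms subgroup.mem_carrier by metis
  have finP: "finite P" using assms(2) card_ge_0_finite prime_gt_0_nat by blast
  interpret S: group "G\<lparr>carrier := P\<rparr>" using subgroup_imp_group[OF assms(1)] .
  have "ord z dvd card P"
    using S.ord_dvd_group_order[of z] assms(3) ord_subgroup[OF assms(1)] by (simp add: order_def)
  moreover have "ord z \<noteq> 1" using ord_eq_1[OF z] assms(4) by blast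
  ultimately show o: "ord z = card P" using assms(2) prime_nat_iff by blast
  have "generate G {z} \<subseteq> P" using generate_subgroup_incl assms by simp
  moreover have "card (generate G {z}) = card P" using o generate_pow_card[OF z] by simp
  ultimately show "P = generate G {z}" using finP card_subset_eq by metis
qed

definition (in group) centralizer :: "'a set \<Rightarrow> 'a set" where
  "centralizer P = {x \<in> carrier G. \<forall>y\<in>P. x \<otimes> y = y \<otimes> x}"

lemma (in group) subgroup_centralizer:
  assumes "P \<subseteq> carrier G"
  shows "subgroup (centralizer P) G"
proof (rule subgroupI)
  fix x assume x: "x \<in> centralizer P"
  show "inv x \<in> centralizer P"
    unfolding centralizer_def
  proof (intro CollectI conjI ballI)
    show "inv x \<in> carrier G" using x by (simp add: centralizer_def)
    fix y assume y: "y \<in> P"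
    have c: "x \<in> carrier G" "y \<in> carrier G" "x \<otimes> y = y \<otimes> x"
      using x y assms by (auto simp: centralizer_def)
    have "inv x \<otimes> y = inv x \<otimes> (y \<otimes> x) \<otimes> inv x" using c(1,2) by (simp add: m_assoc)
    also have "\<dots> = inv x \<otimes> (x \<otimes> y) \<otimes> inv x" by (simp only: c(3))
    also have "\<dots> = y \<otimes> inv x" using c(1,2) by (simp add: m_assoc[symmetric])
    finally show "inv x \<otimes> y = y \<otimes> inv x" .
  qed
next
  fix x x' assume x: "x \<in> centralizer P" "x' \<in> centralizer P"
  have "x \<otimes> x' \<otimes> y = y \<otimes> (x \<otimes> x')" if "y \<in> P" for y
    using x that assms by (simp add: centralizer_def subset_iff) (metis m_assoc)
  then show "x \<otimes> x' \<in> centralizer P" using x by (simp add: centralizer_def)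
qed (use assms in \<open>auto simp: centralizer_def subset_iff\<close>)

lemma (in group) cauchy_subgroup:
  assumes "finite (carrier G)" "Factorial_Ring.prime p" "p dvd order G"
  obtains P where "subgroup P G" "card P = p"
proof -
  \<comment> \<open>Here \<open>p\<close> may divide \<open>m\<close> again: the Sylow theorem used
    provides subgroups for every power of \<open>p\<close> dividing the order.\<close>
  obtain m where "order G = p ^ 1 * m" using assms(3) by (auto elim: dvdE)
  from sylow_thm[OF assms(2) is_group this assms(1)] show ?thesis using that by auto
qed

lemma (in group) prime_order_subgroup_commute:
  assumes "subgroup P G" "Factorial_Ring.prime (card P)" "a \<in> P" "b \<in> P"
  shows "a \<otimes> b = b \<otimes> a"
proof (cases "a = \<one>")
  case True
  then show ?thesis using assms(1,4) subgroup.mem_carrier by fastforce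
next
  case False
  have a: "a \<in> carrier G" using assms(1,3) subgroup.mem_carrier by fastforce
  have "b \<in> generate G {a}" using prime_order_subgroup_generate(1)[OF assms(1-3) False] assms(4) by blast
  then obtain j :: int where "b = a [^] j" using generate_pow[OF a] by blast
  then show ?thesis using a int_pow_mult[of a 1 j] int_pow_mult[of a j 1] by (simp add: add.commute)
qed

lemma (in group) conjugate_set_eq:
  "g <# A #> inv g = (\<lambda>x. g \<otimes> x \<otimes> inv g) ` A"
  by (auto simp: l_coset_def r_coset_def)

lemma (in group) inj_on_conjugate:
  assumes "g \<in> carrier G" "A \<subseteq> carrier G"
  shows "inj_on (\<lambda>x. g \<otimes> x \<otimes> inv g) A"
  using assms by (intro inj_onI) (simp add: subset_iff)

text \<open>A group of prime order \<open>r > p\<close> normalizing \<open>P\<close> centralizes it, since its conjugation orbits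
  on \<open>P\<close> have fewer than \<open>r\<close> elements.\<close>

lemma (in group) primes_above_normalizer_eq_centralizer:
  assumes fin: "finite (carrier G)" and P: "subgroup P G" "card P = p" "Factorial_Ring.prime p"
    and N: "subgroup N G" "centralizer P \<subseteq> N" "\<And>g x. g \<in> N \<Longrightarrow> x \<in> P \<Longrightarrow> g \<otimes> x \<otimes> inv g \<in> P"
  shows "primes_above p (card N) = primes_above p (card (centralizer P))"
proof (rule primes_above_cong)
  fix r :: nat assume r: "Factorial_Ring.prime r" "p < r"
  have Pc: "P \<subseteq> carrier G" using P(1) subgroup.subset by blast
  have sC: "subgroup (centralizer P) G" by (rule subgroup_centralizer[OF Pc])
  have Nc: "N \<subseteq> carrier G" using N(1) subgroup.subset by blast
  interpret N: group "G\<lparr>carrier := N\<rparr>" using subgroup_imp_group[OF N(1)] .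
  have CN: "card (centralizer P) dvd card N"
    using card_subgroup_dvd[OF sC N(1,2)] .
  show "r dvd card N \<longleftrightarrow> r dvd card (centralizer P)"
  proof
    assume "r dvd card (centralizer P)"
    then show "r dvd card N" using CN dvd_trans by blast
  next
    assume "r dvd card N"
    moreover have "finite N" using fin Nc finite_subset by blast
    ultimately obtain R where R: "subgroup R (G\<lparr>carrier := N\<rparr>)" "card R = r"
      by (rule_tac N.cauchy_subgroup[of r]) (use r(1) in \<open>auto simp: order_def\<close>)
    have sR: "subgroup R G" using incl_subgroup[OF N(1) R(1)] .
    have RN: "R \<subseteq> N" using subgroup.subset[OF R(1)] by simp
    have Rc: "R \<subseteq> carrier G" using RN Nc by blast
    obtain z where z: "z \<in> P" "z \<noteq> \<one>"
    proof -
      have "P \<noteq> {\<one>}" using P(2,3) prime_gt_1_nat by force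
      then show ?thesis using that subgroup.one_closed[OF P(1)] by blast
    qed
    have zc: "z \<in> carrier G" using z Pc by blast
    have zord: "Factorial_Ring.prime (card P)" using P by simp
    have Pz: "P = generate G {z}" using prime_order_subgroup_generate(1)[OF P(1) zord z] .
    have cz: "x \<in> centralizer P" if x: "x \<in> carrier G" "x \<otimes> z = z \<otimes> x" for x
    proof -
      have "subgroup (centralizer {x}) G" using x by (intro subgroup_centralizer) simp
      moreover have "z \<in> centralizer {x}" using x zc by (simp add: centralizer_def)
      ultimately have "P \<subseteq> centralizer {x}" unfolding Pz by (intro generate_subgroup_incl) auto
      then show ?thesis using x by (auto simp: centralizer_def)
    qed
    \<comment> \<open>As \<open>z\<close> generates \<open>P\<close>, the set \<open>U\<close> is
      the stabilizer of \<open>z\<close> in \<open>R\<close> under conjugation. Its order is 1 or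
      \<open>r\<close>, and the first would give \<open>z\<close> an orbit of \<open>r\<close>
      elements inside \<open>P\<close>.\<close>
    define U where "U = R \<inter> centralizer P"
    have sU: "subgroup U G" unfolding U_def using subgroups_Inter_pair[OF sR sC] .
    have cU: "card U dvd r"
      using card_subgroup_dvd[OF sU sR] R(2) U_def by blast
    have "card U \<noteq> 1"
    proof
      assume "card U = 1"
      then obtain u where "U = {u}" using card_1_singletonE by blast
      then have U1: "U = {\<one>}" using subgroup.one_closed[OF sU] by simp
      have "inj_on (\<lambda>g. g \<otimes> z \<otimes> inv g) R"
      proof (rule inj_onI)
        fix g h assume gh: "g \<in> R" "h \<in> R" "g \<otimes> z \<otimes> inv g = h \<otimes> z \<otimes> inv h"
        have c: "g \<in> carrier G" "h \<in> carrier G" using gh Rc by auto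
        have "inv h \<otimes> g \<otimes> z = inv h \<otimes> (g \<otimes> z \<otimes> inv g) \<otimes> g" using c zc by (simp add: m_assoc)
        also have "\<dots> = inv h \<otimes> (h \<otimes> z \<otimes> inv h) \<otimes> g" by (simp only: gh(3))
        also have "\<dots> = (inv h \<otimes> h) \<otimes> (z \<otimes> (inv h \<otimes> g))"
          using c zc by (simp only: m_assoc m_closed inv_closed)
        also have "\<dots> = z \<otimes> (inv h \<otimes> g)" using c zc by simp
        finally have "inv h \<otimes> g \<in> centralizer P" using c by (intro cz) auto
        then have "inv h \<otimes> g \<in> U"
          using gh sR by (simp add: U_def subgroup.m_closed subgroup.m_inv_closed)
        then have "inv h \<otimes> g = \<one>" using U1 by simp
        then show "g = h" using c by (metis inv_closed inv_equality inv_inv inv_comm)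
      qed
      moreover have "(\<lambda>g. g \<otimes> z \<otimes> inv g) ` R \<subseteq> P" using N(3) RN z by blast
      moreover have "finite P" using fin Pc finite_subset by blast
      ultimately have "card R \<le> card P" by (rule card_inj_on_le)
      then show False using R(2) P(2) r(2) by simp
    qed
    then have "card U = r" using cU r(1) prime_nat_iff by blast
    then have "U = R" using R(2) Rc fin finite_subset by (intro card_subset_eq) (auto simp: U_def)
    then show "r dvd card (centralizer P)"
      using card_subgroup_dvd[OF sR sC] R(2) U_def by blast
  qed
qed

section \<open>Counting elements through centralizers and conjugacy classes\<close>

text \<open>In its own centralizer \<open>P\<close> is central, so there the count at level
  \<open>t\<close> is \<open>p\<close> times the count at level \<open>p\<close>. By
  \<open>IH\<close> both are known, and their difference is the number claimed.\<close>

lemma (in group) card_ord_primes_above_centralizer: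
  assumes fin: "finite (carrier G)" and sq: "squarefree (order G)"
    and p: "Factorial_Ring.prime p" "p = Suc t"
    and P: "subgroup P G" "card P = p"
    and IH: "card (ord_primes_above t (G\<lparr>carrier := centralizer P\<rparr>)) = primes_above t (card (centralizer P))"
  shows "card ((ord_primes_above t G - ord_primes_above p G) \<inter> centralizer P) =
    (p - 1) * primes_above p (card (centralizer P))"
proof -
  let ?C = "centralizer P"
  have Pc: "P \<subseteq> carrier G" using P(1) subgroup.subset by blast
  have sC: "subgroup ?C G" by (rule subgroup_centralizer[OF Pc])
  have Cc: "?C \<subseteq> carrier G" using sC subgroup.subset by blast
  have finC: "finite ?C" using fin Cc finite_subset by blast
  have PC: "P \<subseteq> ?C"
    using prime_order_subgroup_commute[OF P(1)] P(2) p(1) Pc by (auto simp: centralizer_def)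
  interpret C: group "G\<lparr>carrier := ?C\<rparr>" using subgroup_imp_group[OF sC] .
  have sP: "subgroup P (G\<lparr>carrier := ?C\<rparr>)" using subgroup_incl[OF P(1) sC PC] .
  have "card ?C dvd order G" using lagrange[OF sC] by (metis dvd_triv_right)
  then have sqC: "squarefree (card ?C)" using sq squarefree_mono by blast
  have pC: "p dvd card ?C" using card_subgroup_dvd[OF P(1) sC PC] P(2) by simp
  have "card (ord_primes_above t (G\<lparr>carrier := ?C\<rparr>)) = p * card (ord_primes_above (Suc t) (G\<lparr>carrier := ?C\<rparr>))"
  proof (rule C.card_ord_primes_above_central[OF _ p sP P(2)])
    show "z \<otimes>\<^bsub>G\<lparr>carrier := ?C\<rparr>\<^esub> x = x \<otimes>\<^bsub>G\<lparr>carrier := ?C\<rparr>\<^esub> z"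
      if "z \<in> P" "x \<in> carrier (G\<lparr>carrier := ?C\<rparr>)" for z x
      using that by (simp add: centralizer_def)
  qed (use finC sqC in \<open>auto simp: order_def\<close>)
  then have e: "card (ord_primes_above t G \<inter> ?C) = p * card (ord_primes_above p G \<inter> ?C)"
    by (simp add: ord_primes_above_subgroup[OF sC] p(2))
  have "card ?C > 0" using finC PC P(2) p(1) prime_gt_0_nat by (metis card_gt_0_iff empty_iff subgroup.one_closed sC)
  then have "primes_above t (card ?C) = p * primes_above p (card ?C)"
    using primes_above_Suc[of "card ?C" t] p pC by simp
  then have "p * card (ord_primes_above p G \<inter> ?C) = p * primes_above p (card ?C)"
    using IH e by (simp add: ord_primes_above_subgroup[OF sC])
  then have c: "card (ord_primes_above p G \<inter> ?C) = primes_above p (card ?C)"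
    using prime_gt_0_nat[OF p(1)] by simp
  have "card ((ord_primes_above t G - ord_primes_above p G) \<inter> ?C) =
      card (ord_primes_above t G \<inter> ?C) - card (ord_primes_above p G \<inter> ?C)"
  proof -
    have "(ord_primes_above t G - ord_primes_above p G) \<inter> ?C =
      (ord_primes_above t G \<inter> ?C) - (ord_primes_above p G \<inter> ?C)" by blast
    moreover have "ord_primes_above p G \<inter> ?C \<subseteq> ord_primes_above t G \<inter> ?C"
      using ord_primes_above_antimono[of t] p(2) by blast
    ultimately show ?thesis using finC by (simp add: card_Diff_subset)
  qed
  then show ?thesis using e c by (simp add: diff_mult_distrib)
qed

text \<open>If \<open>x\<close> centralizes \<open>P\<close>, then \<open>P\<close> is central in a
  group containing \<open>x\<close>, and so contains every element there whose \<open>p\<close>-th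
  power is trivial, in particular the power of \<open>x\<close> of order \<open>p\<close>. Thus
  \<open>x\<close> determines \<open>P\<close>.\<close>

lemma (in group) centralizer_unique:
  assumes fin: "finite (carrier G)" and sq: "squarefree (order G)" and p: "Factorial_Ring.prime p"
    and x: "x \<in> carrier G" "p dvd ord x"
  shows "subgroup P G \<and> card P = p \<and> x \<in> centralizer P \<longleftrightarrow> P = generate G {x [^] (ord x div p)}"
proof -
  define w where "w = x [^] (ord x div p)"
  have w: "w \<in> carrier G" using x by (simp add: w_def)
  have "ord x > 0" using ord_ge_1[OF fin x(1)] by simp
  then have ow: "ord w = p"
    using ord_pow[OF x(1), of "ord x div p"] x(2) unfolding w_def
    by (auto elim!: dvdE)
  show ?thesis unfolding w_def[symmetric]
  proof
    assume "subgroup P G \<and> card P = p \<and> x \<in> centralizer P"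
    then have P: "subgroup P G" "card P = p" "x \<in> centralizer P" by auto
    let ?C = "centralizer P"
    have Pc: "P \<subseteq> carrier G" using P(1) subgroup.subset by blast
    have sC: "subgroup ?C G" by (rule subgroup_centralizer[OF Pc])
    have PC: "P \<subseteq> ?C"
      using prime_order_subgroup_commute[OF P(1)] P(2) p(1) Pc by (auto simp: centralizer_def)
    interpret C: group "G\<lparr>carrier := ?C\<rparr>" using subgroup_imp_group[OF sC] .
    have sP: "subgroup P (G\<lparr>carrier := ?C\<rparr>)" using subgroup_incl[OF P(1) sC PC] .
    have "card ?C dvd order G" using lagrange[OF sC] by (metis dvd_triv_right)
    then have sqC: "squarefree (order (G\<lparr>carrier := ?C\<rparr>))" using sq squarefree_mono by (auto simp: order_def)
    have Peq: "P = {y \<in> carrier (G\<lparr>carrier := ?C\<rparr>). y [^]\<^bsub>G\<lparr>carrier := ?C\<rparr>\<^esub> p = \<one>\<^bsub>G\<lparr>carrier := ?C\<rparr>\<^esub>}"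
    proof (rule C.central_prime_order_subgroup_eq[OF p sP P(2) _ sqC])
      show "z \<otimes>\<^bsub>G\<lparr>carrier := ?C\<rparr>\<^esub> x = x \<otimes>\<^bsub>G\<lparr>carrier := ?C\<rparr>\<^esub> z"
        if "z \<in> P" "x \<in> carrier (G\<lparr>carrier := ?C\<rparr>)" for z x
        using that by (simp add: centralizer_def)
    qed
    have "w \<in> ?C"
      using C.nat_pow_closed[of x "ord x div p"] P(3) by (simp add: w_def nat_pow_consistent[symmetric])
    moreover have "w [^] p = \<one>" using pow_ord_eq_1[OF w] ow by simp
    ultimately have "w \<in> P" by (subst Peq) (simp add: nat_pow_consistent[symmetric])
    moreover have "w \<noteq> \<one>" using ow p by auto
    ultimately show "P = generate G {w}"
      using prime_order_subgroup_generate(1)[OF P(1)] P(2) p by simp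
  next
    assume P: "P = generate G {w}"
    have "subgroup (centralizer {x}) G" using x by (intro subgroup_centralizer) simp
    moreover have "w \<in> centralizer {x}"
      using w group_commutes_pow[of x x] x by (simp add: centralizer_def w_def)
    ultimately have "P \<subseteq> centralizer {x}" unfolding P by (intro generate_subgroup_incl) auto
    then have "x \<in> centralizer P" using x by (auto simp: centralizer_def)
    then show "subgroup P G \<and> card P = p \<and> x \<in> centralizer P"
      using P generate_is_subgroup[of "{w}"] w ow generate_pow_card[OF w] by simp
  qed
qed

text \<open>Each element of \<open>B\<close>, the set being removed, centralizes exactly one subgroup of order \<open>p\<close>.
  Summing over conjugacy classes of these subgroups shows that \<open>card B\<close> is a positive multiple of
  \<open>(p - 1) * w\<close> below \<open>p * w\<close>, which forces equality with \<open>(p - 1) * w\<close>.\<close>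

lemma (in group) card_ord_primes_above_step:
  assumes fin: "finite (carrier G)" and sq: "squarefree (order G)"
    and p: "Factorial_Ring.prime p" "p = Suc t" and pG: "p dvd order G"
    and IH: "\<And>(G' :: ('a, 'b) monoid_scheme). group G' \<Longrightarrow> finite (carrier G') \<Longrightarrow>
      squarefree (order G') \<Longrightarrow> card (ord_primes_above t G') = primes_above t (order G')"
  shows "card (ord_primes_above p G) = primes_above p (order G)"
proof -
  define w where "w = primes_above p (order G)"
  define B where "B = ord_primes_above t G - ord_primes_above p G"
  define \<P> where "\<P> = {P. subgroup P G \<and> card P = p}"
  define \<phi> where "\<phi> = (\<lambda>g. \<lambda>H \<in> {H. subgroup H G}. g <# H #> inv g)"
  \<comment> \<open>The value 0 off \<open>\<P>\<close> allows the sum to range over all subgroups,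
    the set on which the conjugation action \<open>\<phi>\<close> lives and which splits into
    orbits.\<close>
  define f where "f H = (if H \<in> \<P> then (p - 1) * primes_above p (card (stabilizer G \<phi> H)) else 0)" for H
  interpret \<phi>: group_action G "{H. subgroup H G}" \<phi>
    unfolding \<phi>_def by (rule action_by_conjugation_on_subgroups_set)
  have finS: "finite {H. subgroup H G}"
    by (rule finite_subset[of _ "Pow (carrier G)"]) (use fin in \<open>auto dest: subgroup.subset\<close>)
  have og: "order G > 0" using fin order_gt_0_iff_finite by blast
  have fE: "finite (ord_primes_above s G)" for s
    using fin by (rule finite_subset[rotated]) (auto simp: ord_primes_above_def)
  have \<phi>: "\<phi> g H = (\<lambda>x. g \<otimes> x \<otimes> inv g) ` H" if "subgroup H G" for g H
    using that by (simp add: \<phi>_def conjugate_set_eq)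
  have sqC: "squarefree (card C)" if "subgroup C G" for C
  proof -
    have "card C dvd order G" using lagrange[OF that] by (metis dvd_triv_right)
    then show ?thesis using sq squarefree_mono by blast
  qed
  have cB: "card (B \<inter> centralizer P) = f P" if P: "P \<in> \<P>" for P
  proof -
    have P': "subgroup P G" "card P = p" using P by (auto simp: \<P>_def)
    have Pc: "P \<subseteq> carrier G" using P'(1) subgroup.subset by blast
    have sC: "subgroup (centralizer P) G" by (rule subgroup_centralizer[OF Pc])
    have fC: "finite (centralizer P)" using subgroup.subset[OF sC] fin finite_subset by blast
    have "card (B \<inter> centralizer P) = (p - 1) * primes_above p (card (centralizer P))"
      unfolding B_def
    proof (rule card_ord_primes_above_centralizer[OF fin sq p P'])
      show "card (ord_primes_above t (G\<lparr>carrier := centralizer P\<rparr>)) = primes_above t (card (centralizer P))"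
        using IH[OF subgroup_imp_group[OF sC]] fC sqC[OF sC] by (simp add: order_def)
    qed
    \<comment> \<open>The stabilizer is the normalizer of \<open>P\<close>; its order, unlike that
      of the centralizer, is tied to the orbit length by the orbit-stabilizer theorem.\<close>
    also have "primes_above p (card (centralizer P)) = primes_above p (card (stabilizer G \<phi> P))"
    proof (rule primes_above_normalizer_eq_centralizer[OF fin P' p(1), symmetric])
      show "subgroup (stabilizer G \<phi> P) G" using \<phi>.stabilizer_subgroup P'(1) by simp
      show "centralizer P \<subseteq> stabilizer G \<phi> P"
      proof
        fix g assume g: "g \<in> centralizer P"
        then have gc: "g \<in> carrier G" by (simp add: centralizer_def)
        have "g \<otimes> x \<otimes> inv g = x" if "x \<in> P" for x
        proof -
          have "g \<otimes> x \<otimes> inv g = x \<otimes> g \<otimes> inv g" using g that by (simp add: centralizer_def)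
          then show ?thesis using gc that Pc by (simp add: m_assoc subset_iff)
        qed
        then have "\<phi> g P = P" using \<phi>[OF P'(1)] by simp
        then show "g \<in> stabilizer G \<phi> P" using gc by (simp add: stabilizer_def)
      qed
      show "g \<otimes> x \<otimes> inv g \<in> P" if "g \<in> stabilizer G \<phi> P" "x \<in> P" for g x
        using that \<phi>[OF P'(1), of g] by (auto simp: stabilizer_def)
    qed
    finally show ?thesis using P by (simp add: f_def)
  qed
  have B: "B = {x \<in> ord_primes_above t G. p dvd ord x}"
    unfolding B_def using ord_primes_above_Suc[of t] p by simp
  have Bx: "x \<in> carrier G" "p dvd ord x" if "x \<in> B" for x
    using that B by (auto simp: ord_primes_above_def)
  have "B = (\<Union>P\<in>\<P>. B \<inter> centralizer P)"
    using centralizer_unique[OF fin sq p(1) Bx] unfolding \<P>_def by blast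
  then have "card B = card (\<Union>P\<in>\<P>. B \<inter> centralizer P)" by simp
  also have "\<dots> = (\<Sum>P\<in>\<P>. card (B \<inter> centralizer P))"
  proof (rule card_UN_disjoint)
    show "finite \<P>" using finS by (rule finite_subset[rotated]) (auto simp: \<P>_def)
    show "\<forall>P\<in>\<P>. finite (B \<inter> centralizer P)" using fE by (auto simp: B_def)
    show "\<forall>P\<in>\<P>. \<forall>Q\<in>\<P>. P \<noteq> Q \<longrightarrow> (B \<inter> centralizer P) \<inter> (B \<inter> centralizer Q) = {}"
      using centralizer_unique[OF fin sq p(1) Bx] unfolding \<P>_def by blast
  qed
  also have "\<dots> = (\<Sum>P\<in>\<P>. f P)" using cB by (rule sum.cong[OF refl])
  also have "\<dots> = (\<Sum>P\<in>{H. subgroup H G}. f P)"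
    using finS by (intro sum.mono_neutral_left) (auto simp: \<P>_def f_def)
  also have "\<dots> = (\<Sum>orb\<in>orbits G {H. subgroup H G} \<phi>. \<Sum>P\<in>orb. f P)"
    by (rule \<phi>.disjoint_sum[OF finS, symmetric])
  finally have cardB: "card B = (\<Sum>orb\<in>orbits G {H. subgroup H G} \<phi>. \<Sum>P\<in>orb. f P)" .
  have "(p - 1) * w dvd card B"
    unfolding cardB
  proof (rule dvd_sum)
    fix orb assume orb: "orb \<in> orbits G {H. subgroup H G} \<phi>"
    then obtain H where H: "subgroup H G" "orb = orbit G \<phi> H" by (auto simp: orbits_def)
    \<comment> \<open>Conjugate subgroups have equal orders, and the orbit-stabilizer theorem on
      their common orbit gives stabilizers of equal orders.\<close>
    have f: "f K = f H" if K: "K \<in> orb" for K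
    proof -
      obtain g where g: "g \<in> carrier G" "K = \<phi> g H" using K H by (auto simp: orbit_def)
      have sK: "subgroup K G" using \<phi>.element_image[OF g(1), of H K] H g by simp
      have "card K = card H"
        unfolding g(2) \<phi>[OF H(1)] by (rule card_image[OF inj_on_conjugate[OF g(1) subgroup.subset[OF H(1)]]])
      then have KP: "K \<in> \<P> \<longleftrightarrow> H \<in> \<P>" using sK H(1) by (simp add: \<P>_def)
      have "orbit G \<phi> K = orbit G \<phi> H"
      proof -
        have "K \<in> orbit G \<phi> K" using \<phi>.orbit_refl sK by simp
        then show ?thesis
          using \<phi>.disjoint_union[of "orbit G \<phi> K" "orbit G \<phi> H"] sK H K by (auto simp: orbits_def)
      qed
      then have "card (orbit G \<phi> H) * card (stabilizer G \<phi> K) = card (orbit G \<phi> H) * card (stabilizer G \<phi> H)"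
        using \<phi>.orbit_stabilizer_theorem[of K] \<phi>.orbit_stabilizer_theorem[of H] sK H(1) by simp
      moreover have "card (orbit G \<phi> H) \<noteq> 0"
        using \<phi>.orbit_stabilizer_theorem[of H] H(1) og by (metis mem_Collect_eq mult_0 less_irrefl)
      ultimately have "card (stabilizer G \<phi> K) = card (stabilizer G \<phi> H)" by simp
      then show ?thesis using KP by (simp add: f_def)
    qed
    have "(\<Sum>P\<in>orb. f P) = card orb * f H" using f by simp
    moreover have "(p - 1) * w dvd card orb * f H"
    proof (cases "H \<in> \<P>")
      case True
      have o: "order G = card orb * card (stabilizer G \<phi> H)"
        using \<phi>.orbit_stabilizer_theorem[of H] H by simp
      \<comment> \<open>Since \<open>order G\<close> is the orbit length times the stabilizer order,
        primes above \<open>p\<close> missing from the stabilizer order are supplied by the orbit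
        length.\<close>
      then have "w dvd card orb * primes_above p (card (stabilizer G \<phi> H))"
        unfolding w_def o using og by (intro primes_above_mult_dvd) (auto simp: o)
      then have "(p - 1) * w dvd (p - 1) * (card orb * primes_above p (card (stabilizer G \<phi> H)))"
        by (rule mult_dvd_mono[OF dvd_refl])
      then show ?thesis using True by (simp add: f_def mult_ac)
    qed (simp add: f_def)
    ultimately show "(p - 1) * w dvd (\<Sum>P\<in>orb. f P)" by simp
  qed
  then obtain k where k: "card B = (p - 1) * w * k" by (auto elim: dvdE)
  have cE: "card (ord_primes_above t G) = p * w"
    using IH[OF is_group fin sq] primes_above_Suc[OF og, of t] p pG by (simp add: w_def)
  have sub: "ord_primes_above p G \<subseteq> ord_primes_above t G"
    using ord_primes_above_antimono p(2) by blast
  have "\<one> \<in> ord_primes_above p G" by (auto simp: ord_primes_above_def)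
  then have pos: "card (ord_primes_above p G) > 0" using fE card_gt_0_iff by blast
  have split: "card B + card (ord_primes_above p G) = p * w"
    unfolding B_def using card_Diff_subset[OF fE sub] card_mono[OF fE sub] cE by simp
  have "card B > 0"
  proof -
    obtain P where P: "subgroup P G" "card P = p" using cauchy_subgroup[OF fin p(1) pG] by blast
    obtain z where z: "z \<in> P" "z \<noteq> \<one>"
    proof -
      have "P \<noteq> {\<one>}" using P(2) p(1) prime_gt_1_nat by force
      then show ?thesis using that subgroup.one_closed[OF P(1)] by blast
    qed
    have "ord z = p" using prime_order_subgroup_generate(2)[OF P(1) _ z] P(2) p(1) by simp
    moreover have "z \<in> carrier G" using z P(1) subgroup.mem_carrier by metis
    moreover have "q = p" if "Factorial_Ring.prime q" "q dvd p" for q using that p(1) primes_dvd_imp_eq by blast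
    ultimately have "z \<in> B" unfolding B using p(2) by (auto simp: ord_primes_above_def)
    then show ?thesis using fE by (metis B_def card_gt_0_iff empty_iff finite_Diff)
  qed
  have p2: "p \<ge> 2" using p(1) prime_ge_2_nat by blast
  have "k = 1"
  proof (rule ccontr)
    assume "k \<noteq> 1"
    moreover have "k \<noteq> 0" using k \<open>card B > 0\<close> by (cases k) auto
    ultimately have "(p - 1) * w * 2 \<le> card B" unfolding k by (intro mult_le_mono2) simp
    moreover have "p * w \<le> (p - 1) * w * 2"
    proof -
      have "p \<le> (p - 1) * 2" using p2 by simp
      then have "p * w \<le> ((p - 1) * 2) * w" by (rule mult_le_mono1)
      then show ?thesis by (simp add: mult_ac)
    qed
    ultimately show False using split pos by linarith
  qed
  moreover have "p * w = (p - 1) * w + w" using p2 by (cases p) auto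
  ultimately show ?thesis using k split unfolding w_def[symmetric] by simp
qed

text \<open>At level 0 the set is the whole group, and passing from \<open>t\<close> to
  \<open>Suc t\<close> changes something only if \<open>Suc t\<close> is a prime divisor of the
  order. The group stays arbitrary in the induction because the step uses the hypothesis for
  centralizers as well.\<close>

theorem card_ord_primes_above:
  fixes G :: "('a, 'b) monoid_scheme"
  assumes "group G" "finite (carrier G)" "squarefree (order G)"
  shows "card (ord_primes_above t G) = primes_above t (order G)"
  using assms
proof (induction t arbitrary: G)
  case 0
  then interpret group G by simp
  have "ord_primes_above 0 G = carrier G"
    using prime_gt_0_nat by (auto simp: ord_primes_above_def)
  then show ?case using primes_above_0[OF 0(3)] by (simp add: order_def)
next
  case (Suc t)
  interpret group G by (rule Suc.prems)
  have og: "order G > 0" using Suc.prems(2) order_gt_0_iff_finite by blast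
  show ?case
  proof (cases "Factorial_Ring.prime (Suc t) \<and> Suc t dvd order G")
    case True
    then show ?thesis
      using card_ord_primes_above_step[OF Suc.prems(2,3) _ refl _ Suc.IH] by blast
  next
    case False
    have "ord_primes_above t G - ord_primes_above (Suc t) G = {}"
      unfolding ord_primes_above_Suc
      using False ord_dvd_group_order by (auto simp: ord_primes_above_def dest: dvd_trans)
    then have "ord_primes_above (Suc t) G = ord_primes_above t G"
      using ord_primes_above_antimono by blast
    then show ?thesis using Suc.IH[OF Suc.prems] primes_above_Suc[OF og, of t] False by simp
  qed
qed

text \<open>For the largest prime divisor \<open>q\<close>, a subgroup of order \<open>q\<close> already exhausts
  the \<open>q\<close> elements all of whose prime divisors of the order exceed \<open>q - 1\<close>.\<close>

corollary (in group) squarefree_order_characteristic_prime_subgroup: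
  assumes fin: "finite (carrier G)" and sq: "squarefree (order G)" and nt: "order G \<noteq> 1"
  obtains q where "Factorial_Ring.prime q" "subgroup {x \<in> carrier G. x [^] q = \<one>} G"
    "card {x \<in> carrier G. x [^] q = \<one>} = q"
proof -
  define q where "q = Max (prime_factors (order G))"
  have og: "order G > 0" using fin order_gt_0_iff_finite by blast
  have "prime_factors (order G) \<noteq> {}" using og nt by (simp add: prime_factorization_empty_iff)
  then have qm: "q \<in> prime_factors (order G)" unfolding q_def by (intro Max_in) auto
  then have q: "Factorial_Ring.prime q" "q dvd order G" by auto
  have max: "r \<le> q" if "Factorial_Ring.prime r" "r dvd order G" for r
    unfolding q_def using that og by (intro Max_ge) (auto simp: prime_factors_dvd)
  \<comment> \<open>The bound is strict, so level \<open>q - 1\<close> still admits the prime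
    \<open>q\<close>, and by maximality no other.\<close>
  define E where "E = ord_primes_above (q - 1) G"
  have "{p. Factorial_Ring.prime p \<and> p dvd order G \<and> q - 1 < p} = {q}"
  proof (intro equalityI subsetI)
    fix r assume "r \<in> {p. Factorial_Ring.prime p \<and> p dvd order G \<and> q - 1 < p}"
    then have "r \<le> q" "q - 1 < r" using max by auto
    then show "r \<in> {q}" by simp
  qed (use q prime_gt_0_nat[OF q(1)] in simp)
  then have cE: "card E = q"
    using card_ord_primes_above[OF is_group fin sq, of "q - 1"] by (simp add: E_def primes_above_def)
  obtain P where P: "subgroup P G" "card P = q" using cauchy_subgroup[OF fin q] by blast
  define R where "R = {x \<in> carrier G. x [^] q = \<one>}"
  have finR: "finite R" using fin by (simp add: R_def)
  have PR: "P \<subseteq> R"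
  proof
    fix x assume x: "x \<in> P"
    interpret S: group "G\<lparr>carrier := P\<rparr>" using subgroup_imp_group[OF P(1)] .
    have "x [^] q = \<one>"
      using S.pow_order_eq_1[of x] x P(2) by (simp add: order_def nat_pow_consistent[symmetric])
    then show "x \<in> R" using x P(1) subgroup.mem_carrier by (fastforce simp: R_def)
  qed
  have RE: "R \<subseteq> E"
  proof
    fix x assume "x \<in> R"
    then have x: "x \<in> carrier G" "ord x dvd q" using pow_eq_id by (auto simp: R_def)
    have "q - 1 < r" if "Factorial_Ring.prime r" "r dvd ord x" for r
    proof -
      have "r = q" using that x(2) q(1) by (meson dvd_trans primes_dvd_imp_eq)
      then show ?thesis using prime_gt_0_nat[OF q(1)] by simp
    qed
    then show "x \<in> E" using x by (simp add: E_def ord_primes_above_def)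
  qed
  have "finite E" using cE prime_gt_0_nat[OF q(1)] card_ge_0_finite by metis
  then have "card R \<le> q" using card_mono[OF _ RE] cE by simp
  then have "P = R" using card_seteq[OF finR PR] P(2) by simp
  then show ?thesis using that[OF q(1)] P unfolding R_def by simp
qed

section \<open>Square-free normal subgroups of the derived subgroup\<close>

text \<open>Conjugation by any element acts on the cyclic group \<open>Q\<close> by raising to a
  fixed power. Such maps commute with each other, so commutators act trivially on
  \<open>Q\<close>.\<close>

lemma (in group) derived_subset_centralizer:
  assumes fin: "finite (carrier G)" and Q: "Q \<lhd> G" "Factorial_Ring.prime (card Q)"
  shows "derived G (carrier G) \<subseteq> centralizer Q"
proof -
  interpret Q: normal Q G by (rule Q)
  obtain z where z: "z \<in> Q" "z \<noteq> \<one>"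
  proof -
    have "Q \<noteq> {\<one>}" using Q(2) prime_gt_1_nat by force
    then show ?thesis using that Q.one_closed by blast
  qed
  have zc: "z \<in> carrier G" using z by simp
  have Qz: "Q = {z [^] k | k. k \<in> (UNIV :: nat set)}"
    using prime_order_subgroup_generate(1)[OF Q.subgroup_axioms Q(2) z]
      generate_pow_on_finite_carrier[OF fin zc] by simp
  have conj: "\<exists>i::nat. \<forall>y\<in>Q. a \<otimes> y \<otimes> inv a = y [^] i" if a: "a \<in> carrier G" for a
  proof -
    have "a \<otimes> z \<otimes> inv a \<in> Q" using Q.inv_op_closed2 a z(1) by simp
    then obtain i :: nat where i: "a \<otimes> z \<otimes> inv a = z [^] i" using Qz by blast
    have "a \<otimes> y \<otimes> inv a = y [^] i" if y: "y \<in> Q" for y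
    proof -
      obtain k :: nat where "y = z [^] k" using y Qz by blast
      then show ?thesis
        using conjugate_pow[OF a zc, of k] i zc by (simp add: nat_pow_pow mult.commute)
    qed
    then show ?thesis by blast
  qed
  have "a \<otimes> b \<otimes> inv a \<otimes> inv b \<in> centralizer Q" if ab: "a \<in> carrier G" "b \<in> carrier G" for a b
    unfolding centralizer_def
  proof (intro CollectI conjI ballI)
    show "a \<otimes> b \<otimes> inv a \<otimes> inv b \<in> carrier G" using ab by simp
    fix y assume y: "y \<in> Q"
    then have yc: "y \<in> carrier G" by simp
    obtain i j :: nat where i: "\<And>y. y \<in> Q \<Longrightarrow> a \<otimes> y \<otimes> inv a = y [^] i"
      and j: "\<And>y. y \<in> Q \<Longrightarrow> b \<otimes> y \<otimes> inv b = y [^] j"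
      using conj ab by metis
    \<comment> \<open>Conjugation by \<open>b \<otimes> a\<close> carries \<open>x\<close> to
      \<open>y\<close>, and since the two actions commute so does conjugation by
      \<open>a \<otimes> b\<close>.\<close>
    define x where "x = inv (b \<otimes> a) \<otimes> y \<otimes> (b \<otimes> a)"
    have x: "x \<in> Q" using Q.inv_op_closed1[of "b \<otimes> a" y] ab y by (simp add: x_def)
    have xc: "x \<in> carrier G" using x by simp
    have pw: "x [^] n \<in> Q" for n :: nat
      using monoid.nat_pow_closed[OF group.is_monoid[OF subgroup_imp_group[OF Q.subgroup_axioms]], of x n] x
      by (simp add: nat_pow_consistent[symmetric])
    have "a \<otimes> (b \<otimes> x \<otimes> inv b) \<otimes> inv a = b \<otimes> (a \<otimes> x \<otimes> inv a) \<otimes> inv b"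
      using x xc pw by (simp add: i j nat_pow_pow mult.commute)
    also have "b \<otimes> (a \<otimes> x \<otimes> inv a) \<otimes> inv b = (b \<otimes> a) \<otimes> x \<otimes> inv (b \<otimes> a)"
      using ab xc by (simp add: inv_mult_group m_assoc)
    also have "\<dots> = ((b \<otimes> a) \<otimes> inv (b \<otimes> a)) \<otimes> y \<otimes> ((b \<otimes> a) \<otimes> inv (b \<otimes> a))"
      unfolding x_def using ab yc by (simp only: m_assoc m_closed inv_closed)
    also have "\<dots> = y" using ab yc by simp
    finally have eq: "a \<otimes> (b \<otimes> x \<otimes> inv b) \<otimes> inv a = y" .
    have "y \<otimes> (a \<otimes> b \<otimes> inv a \<otimes> inv b) = a \<otimes> (b \<otimes> x \<otimes> inv b) \<otimes> inv a \<otimes> (a \<otimes> b \<otimes> inv a \<otimes> inv b)"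
      by (simp only: eq)
    also have "\<dots> = a \<otimes> b \<otimes> x \<otimes> (inv b \<otimes> (inv a \<otimes> a) \<otimes> b) \<otimes> inv a \<otimes> inv b"
      using ab xc by (simp only: m_assoc m_closed inv_closed)
    also have "\<dots> = a \<otimes> b \<otimes> x \<otimes> inv (b \<otimes> a)"
      using ab xc by (simp add: inv_mult_group m_assoc)
    also have "\<dots> = a \<otimes> b \<otimes> inv (b \<otimes> a) \<otimes> y \<otimes> ((b \<otimes> a) \<otimes> inv (b \<otimes> a))"
      unfolding x_def using ab yc by (simp only: m_assoc m_closed inv_closed)
    also have "\<dots> = a \<otimes> b \<otimes> inv (b \<otimes> a) \<otimes> y" using ab yc by simp
    also have "\<dots> = a \<otimes> b \<otimes> inv a \<otimes> inv b \<otimes> y"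
      using ab yc by (simp add: inv_mult_group m_assoc)
    finally show "a \<otimes> b \<otimes> inv a \<otimes> inv b \<otimes> y = y \<otimes> (a \<otimes> b \<otimes> inv a \<otimes> inv b)" by simp
  qed
  then have "derived_set G (carrier G) \<subseteq> centralizer Q" by blast
  then show ?thesis
    unfolding derived_def using subgroup_centralizer[OF Q.subset] generate_subgroup_incl by blast
qed

lemma (in group) ord_dvd_card_subgroup:
  assumes "subgroup D G" "x \<in> D"
  shows "ord x dvd card D"
  using group.ord_dvd_group_order[OF subgroup_imp_group[OF assms(1)], of x] assms(2)
  by (simp add: ord_subgroup[OF assms(1)] order_def)

text \<open>Modulo a normal subgroup \<open>Q\<close> of prime order \<open>q\<close>, the image of
  \<open>D\<close> is generated by some \<open>h y\<close> of order \<open>m\<close>, by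
  \<open>IH\<close>. As \<open>D\<close> centralizes \<open>Q\<close> and \<open>q\<close> is
  coprime to \<open>m\<close>, either \<open>y\<close> itself or \<open>y \<otimes> z\<close> with
  \<open>z\<close> a nontrivial element of \<open>Q\<close> has order \<open>m * q\<close>.\<close>

lemma (in group) squarefree_normal_in_derived_cyclic_step:
  assumes fin: "finite (carrier G)" and D: "D \<lhd> G" "D \<subseteq> derived G (carrier G)" "squarefree (card D)"
    and IH: "\<And>(G' :: ('a, 'b) monoid_scheme) D'. card D' < card D \<Longrightarrow> group G' \<Longrightarrow>
      finite (carrier G') \<Longrightarrow> D' \<lhd> G' \<Longrightarrow> D' \<subseteq> derived G' (carrier G') \<Longrightarrow> squarefree (card D') \<Longrightarrow>
      \<exists>x\<in>D'. group.ord G' x = card D'"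
  shows "\<exists>x\<in>D. ord x = card D"
proof (cases "card D = 1")
  case True
  interpret D: normal D G by (rule D)
  show ?thesis using True D.one_closed ord_id by metis
next
  case False
  interpret D: normal D G by (rule D)
  interpret S: group "G\<lparr>carrier := D\<rparr>" using subgroup_imp_group[OF D.subgroup_axioms] .
  have finD: "finite D" using fin D.subset finite_subset by blast
  obtain q where q: "Factorial_Ring.prime q"
    "subgroup {x \<in> carrier (G\<lparr>carrier := D\<rparr>). x [^]\<^bsub>G\<lparr>carrier := D\<rparr>\<^esub> q = \<one>\<^bsub>G\<lparr>carrier := D\<rparr>\<^esub>} (G\<lparr>carrier := D\<rparr>)"
    "card {x \<in> carrier (G\<lparr>carrier := D\<rparr>). x [^]\<^bsub>G\<lparr>carrier := D\<rparr>\<^esub> q = \<one>\<^bsub>G\<lparr>carrier := D\<rparr>\<^esub>} = q"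
    using S.squarefree_order_characteristic_prime_subgroup finD D(3) False by (auto simp: order_def)
  define Q where "Q = {x \<in> D. x [^] q = \<one>}"
  have Q: "subgroup Q (G\<lparr>carrier := D\<rparr>)" "card Q = q"
    using q(2,3) by (simp_all add: Q_def nat_pow_consistent[symmetric])
  have sQ: "subgroup Q G" using incl_subgroup[OF D.subgroup_axioms Q(1)] .
  have QD: "Q \<subseteq> D" by (auto simp: Q_def)
  \<comment> \<open>The power equation cutting \<open>Q\<close> out of the normal subgroup
    \<open>D\<close> is invariant under conjugation by all of \<open>G\<close>.\<close>
  have nQ: "Q \<lhd> G"
    by (rule normal_invI[OF sQ]) (use D.inv_op_closed2 in \<open>auto simp: Q_def conjugate_pow\<close>)
  then interpret Q: normal Q G .
  have cent: "D \<subseteq> centralizer Q" using derived_subset_centralizer[OF fin nQ] Q(2) q(1) D(2) by blast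
  obtain h and G' :: "('a, 'b) monoid_scheme" where hG': "group_hom G G' h" "h ` carrier G = carrier G'"
    "kernel G G' h = Q" "finite (carrier G')" "order G' * card Q = order G"
    using Q.quotient_same_type[OF fin] by blast
  interpret h: group_hom G G' h by fact
  interpret hD: group_hom "G\<lparr>carrier := D\<rparr>" G' h
    by (intro group_hom.intro group_hom_axioms.intro S.is_group h.H.is_group homI) auto
  have "kernel (G\<lparr>carrier := D\<rparr>) G' h = Q" using hG'(3) QD D.subset by (auto simp: kernel_def)
  then have cD: "card D = card (h ` D) * q"
    using hD.card_image_times_card_kernel Q(2) by (simp add: order_def)
  define m where "m = card (h ` D)"
  have cop: "coprime q m" using squarefree_prime_coprime_div[OF D(3) _ q(1)] cD m_def by blast
  have "\<exists>x\<in>h ` D. group.ord G' x = card (h ` D)"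
  proof (rule IH)
    have "card D \<noteq> 0" using D(3) not_squarefree_0[where 'a = nat] by metis
    then have "m > 0" using cD m_def by (cases m) auto
    then show "card (h ` D) < card D" using cD prime_gt_1_nat[OF q(1)] by (simp add: m_def[symmetric])
    show "h ` D \<lhd> G'" using D.surj_hom_normal_subgroup[OF hG'(1,2)] .
    show "h ` D \<subseteq> derived G' (carrier G')"
      using h.derived_img[of "carrier G"] D(2) hG'(2) by auto
    show "squarefree (card (h ` D))" using D(3) cD squarefree_mono by (metis dvd_triv_left)
  qed (use hG' h.H.is_group in auto)
  then obtain y where y: "y \<in> D" "h.H.ord (h y) = m" by (auto simp: m_def)
  have yc: "y \<in> carrier G" using y by simp
  have my: "m dvd n" if "x \<in> carrier G" "h x = h y" "x [^] n = \<one>" for x n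
  proof -
    have "h y [^]\<^bsub>G'\<^esub> n = \<one>\<^bsub>G'\<^esub>" using that h.hom_nat_pow[of x n] by simp
    then show ?thesis using h.H.pow_eq_id[of "h y" n] yc y(2) by simp
  qed
  obtain z where z: "z \<in> Q" "z \<noteq> \<one>"
  proof -
    have "Q \<noteq> {\<one>}" using Q(2) prime_gt_1_nat[OF q(1)] by force
    then show ?thesis using that Q.one_closed by blast
  qed
  have zc: "z \<in> carrier G" using z by simp
  have oz: "ord z = q" using prime_order_subgroup_generate(2)[OF sQ _ z] Q(2) q(1) by simp
  have comm: "y \<otimes> z = z \<otimes> y" using cent y(1) z(1) by (auto simp: centralizer_def)
  have full: "ord x = card D" if x: "x \<in> D" "m dvd ord x" "q dvd ord x" for x
  proof -
    have "q * m dvd ord x" using x cop by (simp add: divides_mult)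
    moreover have "ord x dvd q * m" using ord_dvd_card_subgroup[OF D.subgroup_axioms x(1)] cD by (simp add: m_def mult.commute)
    ultimately show ?thesis using cD m_def by (metis dvd_antisym mult.commute)
  qed
  show ?thesis
  proof (cases "q dvd ord y")
    case True
    then show ?thesis using full[OF y(1)] my[OF yc refl] y(1) yc by auto
  next
    case False
    have yz: "y \<otimes> z \<in> D" "y \<otimes> z \<in> carrier G" using y(1) z(1) QD by auto
    have hz: "h z = \<one>\<^bsub>G'\<^esub>" using z(1) hG'(3) by (auto simp: kernel_def)
    define n where "n = ord (y \<otimes> z)"
    have n1: "(y \<otimes> z) [^] n = \<one>" using yz pow_ord_eq_1 n_def by blast
    have "h (y \<otimes> z) = h y" using hz yc zc by simp
    then have mn: "m dvd n" using my[OF yz(2) _ n1] by blast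
    have yn: "y [^] n \<otimes> z [^] n = \<one>" using n1 pow_mult_distrib[OF comm yc zc] by simp
    have "ord y dvd q * m"
      using ord_dvd_card_subgroup[OF D.subgroup_axioms y(1)] cD by (simp add: m_def mult.commute)
    moreover have "coprime (ord y) q" using False q(1) prime_imp_coprime coprime_commute by blast
    ultimately have "ord y dvd m" using coprime_dvd_mult_right_iff[of "ord y" q m] by simp
    then have "y [^] n = \<one>" using mn pow_eq_id[OF yc] dvd_trans by blast
    then have "z [^] n = \<one>" using yn zc by simp
    then have "q dvd n" using pow_eq_id[OF zc] oz by simp
    then show ?thesis using full[OF yz(1)] mn yz(1) n_def by blast
  qed
qed

theorem squarefree_normal_in_derived_cyclic:
  fixes G :: "('a, 'b) monoid_scheme"
  assumes "group G" "finite (carrier G)" "D \<lhd> G" "D \<subseteq> derived G (carrier G)" "squarefree (card D)"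
  shows "\<exists>x\<in>D. group.ord G x = card D"
  using assms
proof (induction "card D" arbitrary: G D rule: less_induct)
  case less
  show ?case
    by (rule group.squarefree_normal_in_derived_cyclic_step[OF less.prems less.hyps])
qed

section \<open>Cyclic groups and their subgroups\<close>

lemma (in group) subgroup_generated_subgroup:
  assumes "subgroup D G"
  shows "subgroup_generated G D = G\<lparr>carrier := D\<rparr>"
  using subgroup.carrier_subgroup_generated_subgroup[OF assms]
  by (simp add: subgroup_generated_def)

lemma (in group) cyclic_group_iff_ord:
  assumes "finite (carrier G)"
  shows "cyclic_group G \<longleftrightarrow> (\<exists>x\<in>carrier G. ord x = order G)"
proof
  assume "cyclic_group G"
  then obtain x where x: "x \<in> carrier G" "subgroup_generated G {x} = G" by (auto simp: cyclic_group_def)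
  then show "\<exists>x\<in>carrier G. ord x = order G" using cyclic_order_is_ord[of x] by auto
next
  assume "\<exists>x\<in>carrier G. ord x = order G"
  then obtain x where x: "x \<in> carrier G" "ord x = order G" by blast
  have "generate G {x} \<subseteq> carrier G" using x generate_incl[of "{x}"] by simp
  then have "generate G {x} = carrier G"
    using card_subset_eq[OF assms] x generate_pow_card[of x] by (simp add: order_def)
  then have "subgroup_generated G {x} = G" using x by (simp add: subgroup_generated_def)
  then show "cyclic_group G" using x by (auto simp: cyclic_group_def)
qed

text \<open>With \<open>x\<close> a generator of \<open>D\<close> and \<open>card D = k * l\<close>,
  the power \<open>x [^] l\<close> generates the subgroup wanted. Square-freeness makes
  \<open>k\<close> and \<open>l\<close> coprime, so it is the solution set of
  \<open>y [^] k = \<one>\<close> in \<open>D\<close> and therefore normal in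
  \<open>G\<close>.\<close>

lemma (in group) squarefree_cyclic_normal_subgroup_of_order:
  assumes fin: "finite (carrier G)" and D: "D \<lhd> G" "squarefree (card D)"
    and cyc: "cyclic_group (subgroup_generated G D)" and k: "k dvd card D"
  obtains K where "K \<lhd> G" "K \<subseteq> D" "card K = k" "\<And>a b. a \<in> K \<Longrightarrow> b \<in> K \<Longrightarrow> a \<otimes> b = b \<otimes> a"
proof -
  interpret D: normal D G by (rule D)
  have finD: "finite D" using fin D.subset finite_subset by blast
  let ?S = "G\<lparr>carrier := D\<rparr>"
  have cS: "cyclic_group ?S" using cyc subgroup_generated_subgroup[OF D.subgroup_axioms] by simp
  interpret S: group ?S using subgroup_imp_group[OF D.subgroup_axioms] .
  interpret S: comm_group ?S using S.cyclic_imp_abelian_group[OF cS] .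
  have comm: "a \<otimes> b = b \<otimes> a" if "a \<in> D" "b \<in> D" for a b
    using S.m_comm[of a b] that by simp
  obtain x where x: "x \<in> D" "ord x = card D"
    using S.cyclic_group_iff_ord cS finD by (auto simp: ord_subgroup[OF D.subgroup_axioms] order_def)
  obtain l where l: "card D = k * l" using k by (auto elim: dvdE)
  have "card D \<noteq> 0" using D(2) not_squarefree_0[where 'a = nat] by metis
  then have kl: "k > 0" "l > 0" using l by auto
  define K where "K = generate G {x [^] l}"
  have xl: "x [^] l \<in> D"
    using S.nat_pow_closed[of x l] x by (simp add: nat_pow_consistent[symmetric])
  have KD: "K \<subseteq> D" unfolding K_def using generate_subgroup_incl[OF _ D.subgroup_axioms] xl by simp
  have sK: "subgroup K G" unfolding K_def using generate_is_subgroup xl by simp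
  have "ord (x [^] l) = k" using ord_pow[of x l] x l kl by simp
  then have cK: "card K = k" unfolding K_def using generate_pow_card[of "x [^] l"] xl by simp
  have "subgroup K ?S" using subgroup_incl[OF sK D.subgroup_axioms KD] .
  then have nK: "K \<lhd> ?S" using S.subgroup_imp_normal by blast
  have "card (rcosets\<^bsub>?S\<^esub> K) * k = k * l"
    using S.lagrange[OF normal_imp_subgroup[OF nK]] cK l by (simp add: order_def)
  then have idx: "card (rcosets\<^bsub>?S\<^esub> K) = l" using kl by simp
  have cop: "coprime k l"
  proof (rule coprimeI)
    fix c assume "c dvd k" "c dvd l"
    then have "c ^ 2 dvd card D" unfolding l power2_eq_square by (rule mult_dvd_mono)
    then show "is_unit c" using D(2) squarefreeD by blast
  qed
  have "K = {y \<in> carrier ?S. y [^]\<^bsub>?S\<^esub> k = \<one>\<^bsub>?S\<^esub>}"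
    by (rule normal.coprime_index_imp_eq[OF nK, unfolded cK idx]) (rule cop)
  then have Keq: "K = {y \<in> D. y [^] k = \<one>}" by (simp add: nat_pow_consistent[symmetric])
  have "K \<lhd> G"
  proof (rule normal_invI[OF sK])
    fix g y assume "g \<in> carrier G" "y \<in> K"
    then show "g \<otimes> y \<otimes> inv g \<in> K"
      using D.inv_op_closed2 unfolding Keq by (auto simp: conjugate_pow)
  qed
  then show ?thesis using that KD cK comm by blast
qed

section \<open>Orders of normally embedded subgroups\<close>

definition sigma_embedded_orders :: "nat set set \<Rightarrow> ('a, 'b) monoid_scheme \<Rightarrow> bool" where
  "sigma_embedded_orders \<sigma> G \<longleftrightarrow>
    (\<forall>H. subgroup H G \<longrightarrow> (\<exists>A. H_sigma_normally_embedded \<sigma> A G \<and> card A = card H))"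

lemma (in group) card_subgroup_pos:
  assumes "finite (carrier G)" "subgroup A G"
  shows "card A > 0"
  using subgroup.finite_imp_card_positive[OF assms(2,1)] .

section \<open>Forward direction: bounding the order of the nilpotent residual\<close>

text \<open>Only the normal subgroup containing the \<sigma>-Hall subgroup \<open>A\<close> is kept.
  Its order is \<open>card H\<close> times the index of \<open>A\<close>, and this index involves no
  prime from a block meeting the primes of \<open>card H\<close>.\<close>

lemma (in group) sigma_embedded_orders_imp_normal:
  assumes fin: "finite (carrier G)" and \<sigma>: "\<Union>\<sigma> = {p :: nat. Factorial_Ring.prime p}"
    and L: "sigma_embedded_orders \<sigma> G" and H: "subgroup H G"
  obtains N where "N \<lhd> G" "card H dvd card N"
    "\<And>s r. s \<in> \<sigma> \<Longrightarrow> s \<inter> prime_factors (card H) \<noteq> {} \<Longrightarrow> r \<in> s \<Longrightarrow>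
      multiplicity r (card N) = multiplicity r (card H)"
proof -
  obtain A N where N: "N \<lhd> G" and A: "sigma_Hall_subgroup \<sigma> A (G\<lparr>carrier := N\<rparr>)" and cA: "card A = card H"
    using L H unfolding sigma_embedded_orders_def H_sigma_normally_embedded_def by blast
  have sN: "subgroup N G" using N normal_imp_subgroup by blast
  define i where "i = card (rcosets\<^bsub>G\<lparr>carrier := N\<rparr>\<^esub> A)"
  have sA: "subgroup A (G\<lparr>carrier := N\<rparr>)" and disj: "sigma_of \<sigma> (card H) \<inter> sigma_of \<sigma> i = {}"
    using A by (simp_all add: sigma_Hall_subgroup_def cA i_def)
  then have cN: "card N = i * card H"
    using group.lagrange[OF subgroup_imp_group[OF sN] sA] by (simp add: order_def cA i_def)
  have "card N > 0" "card H > 0" using card_subgroup_pos[OF fin] sN H by auto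
  then have i: "i \<noteq> 0" "card H \<noteq> 0" using cN by auto
  have "multiplicity r (card N) = multiplicity r (card H)"
    if s: "s \<in> \<sigma>" "s \<inter> prime_factors (card H) \<noteq> {}" "r \<in> s" for s r
  proof -
    have r: "Factorial_Ring.prime r" using s \<sigma> by blast
    have "s \<notin> sigma_of \<sigma> i" using disj s by (auto simp: sigma_of_def)
    then have "\<not> r dvd i" using s r i by (auto simp: sigma_of_def prime_factors_dvd)
    then show ?thesis
      using prime_elem_multiplicity_mult_distrib[of r i "card H"] r i
      by (simp add: cN not_dvd_imp_multiplicity_0)
  qed
  then show ?thesis using that[OF N] cN by simp
qed

lemma (in group) sigma_embedded_orders_imp_large_normal:
  assumes fin: "finite (carrier G)" and \<sigma>: "\<Union>\<sigma> = {p :: nat. Factorial_Ring.prime p}"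
    and L: "sigma_embedded_orders \<sigma> G"
    and s: "s \<in> \<sigma>" "p \<in> s" "p dvd order G"
  obtains N where "N \<lhd> G" "multiplicity p (card N) = 1"
    "\<And>r. r \<in> s - {p} \<Longrightarrow> multiplicity r (card N) = 0"
    "prime_factors (card (rcosets N)) \<subseteq> s"
proof -
  have p: "Factorial_Ring.prime p" using s \<sigma> by blast
  \<comment> \<open>That is, \<open>N\<close> is normal and the part of \<open>card N\<close> made
    of primes in \<open>s\<close> is exactly \<open>p\<close>.\<close>
  define P where "P N \<longleftrightarrow> N \<lhd> G \<and> multiplicity p (card N) = 1 \<and> (\<forall>r\<in>s - {p}. multiplicity r (card N) = 0)" for N
  obtain H where H: "subgroup H G" "card H = p" using cauchy_subgroup[OF fin p s(3)] by blast
  have mp: "multiplicity r p = (if r = p then 1 else 0)" if "r \<in> s" for r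
  proof -
    have "Factorial_Ring.prime r" using that \<sigma> s(1) by blast
    then show ?thesis using p by (auto simp: prime_multiplicity_other)
  qed
  obtain N0 where "P N0"
  proof (rule sigma_embedded_orders_imp_normal[OF fin \<sigma> L H(1)])
    fix N assume N: "N \<lhd> G" "card H dvd card N"
      and m: "\<And>s r. s \<in> \<sigma> \<Longrightarrow> s \<inter> prime_factors (card H) \<noteq> {} \<Longrightarrow> r \<in> s \<Longrightarrow>
        multiplicity r (card N) = multiplicity r (card H)"
    have "s \<inter> prime_factors (card H) \<noteq> {}" using s(2) p H(2) by (auto simp: prime_factors_dvd)
    then have "P N" using N(1) m[OF s(1)] s(2) mp unfolding P_def H(2) by auto
    then show ?thesis by (rule that)
  qed
  have bound: "\<forall>N. P N \<longrightarrow> card N < Suc (order G)"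
  proof (intro allI impI)
    fix N assume "P N"
    then have "N \<subseteq> carrier G" using normal_imp_subgroup subgroup.subset unfolding P_def by blast
    then show "card N < Suc (order G)" using card_mono[OF fin] by (simp add: order_def less_Suc_eq_le)
  qed
  obtain N where N: "P N" and max: "\<And>M. P M \<Longrightarrow> card M \<le> card N"
    using ex_has_greatest_nat[OF \<open>P N0\<close> bound] by metis
  interpret N: normal N G using N P_def by blast
  interpret F: group "G Mod N" by (rule N.factorgroup_is_group)
  interpret h: group_hom G "G Mod N" "\<lambda>x. N #> x" by (rule N.group_hom_Mod)
  have oF: "order (G Mod N) = card (rcosets N)" by (simp add: order_def FactGroup_def)
  have finF: "finite (carrier (G Mod N))" using fin by (simp add: carrier_FactGroup)
  have cN: "card N > 0" using card_subgroup_pos[OF fin N.subgroup_axioms] .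
  have "r \<in> s" if r: "Factorial_Ring.prime r" "r dvd card (rcosets N)" for r
  proof (rule ccontr)
    assume rs: "r \<notin> s"
    obtain R where R: "subgroup R (G Mod N)" "card R = r"
      using F.cauchy_subgroup[OF finF r(1)] r(2) oF by metis
    \<comment> \<open>The preimage of \<open>R\<close> has the same multiplicities as
      \<open>N\<close> at primes of \<open>s\<close>, because \<open>r\<close> is outside
      \<open>s\<close>. The normal subgroup obtained for it satisfies \<open>P\<close> again and is
      larger than \<open>N\<close>.\<close>
    define H where "H = {x \<in> carrier G. N #> x \<in> R}"
    have sH: "subgroup H G" unfolding H_def by (rule h.subgroup_preimage[OF R(1)])
    have cH: "card H = r * card N"
      unfolding H_def using h.card_preimage[OF R(1)] subgroup.subset[OF R(1)] R(2)
      by (simp add: N.kernel_Mod carrier_FactGroup)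
    have mH: "multiplicity t (card H) = multiplicity t (card N)" if t: "t \<in> s" for t
    proof -
      have "Factorial_Ring.prime t" using t s(1) \<sigma> by blast
      moreover have "t \<noteq> r" using t rs by blast
      ultimately show ?thesis
        using r(1) cN prime_elem_multiplicity_mult_distrib[of t r "card N"]
        by (simp add: cH prime_multiplicity_other)
    qed
    show False
    proof (rule sigma_embedded_orders_imp_normal[OF fin \<sigma> L sH])
      fix M assume M: "M \<lhd> G" "card H dvd card M"
        and m: "\<And>s r. s \<in> \<sigma> \<Longrightarrow> s \<inter> prime_factors (card H) \<noteq> {} \<Longrightarrow> r \<in> s \<Longrightarrow>
          multiplicity r (card M) = multiplicity r (card H)"
      have "multiplicity p (card H) = 1" using mH[OF s(2)] N by (simp add: P_def)
      then have "p dvd card H" by (metis not_dvd_imp_multiplicity_0 zero_neq_one)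
      then have "s \<inter> prime_factors (card H) \<noteq> {}"
        using s(2) p card_subgroup_pos[OF fin sH] by (auto simp: prime_factors_dvd)
      then have "P M" using M(1) m[OF s(1)] mH N s(2) by (auto simp: P_def)
      then have "card M \<le> card N" by (rule max)
      moreover have "card H \<le> card M"
        using M card_subgroup_pos[OF fin normal_imp_subgroup[OF M(1)]] by (intro dvd_imp_le) auto
      moreover have "card N < card H" using cH cN prime_gt_1_nat[OF r(1)] by simp
      ultimately show False by simp
    qed
  qed
  then have "prime_factors (card (rcosets N)) \<subseteq> s" by auto
  then show ?thesis using that N unfolding P_def by blast
qed

text \<open>The index of the image of \<open>A\<close> in \<open>G Mod N\<close> divides both the index of \<open>A\<close> and that of \<open>N\<close>.\<close>

lemma (in group) Hall_subgroup_onto_quotient: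
  assumes fin: "finite (carrier G)" and A: "Hall_subgroup s A G"
    and N: "N \<lhd> G" "prime_factors (card (rcosets N)) \<subseteq> s"
  shows "(\<lambda>x. N #> x) ` A = carrier (G Mod N)"
proof -
  interpret N: normal N G by (rule N)
  interpret F: group "G Mod N" by (rule N.factorgroup_is_group)
  interpret h: group_hom G "G Mod N" "\<lambda>x. N #> x" by (rule N.group_hom_Mod)
  have sA: "subgroup A G" and iA: "prime_factors (card (rcosets A)) \<inter> s = {}"
    using A by (auto simp: Hall_subgroup_def)
  define I where "I = (\<lambda>x. N #> x) ` A"
  have sI: "subgroup I (G Mod N)" unfolding I_def using h.subgroup_img_is_subgroup[OF sA] .
  \<comment> \<open>This is the product of \<open>A\<close> and \<open>N\<close>. It has index
    \<open>e\<close> in \<open>G\<close> and contains \<open>A\<close> with index \<open>c\<close>,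
    whence \<open>card (rcosets A) = e * c\<close>.\<close>
  define B where "B = {x \<in> carrier G. N #> x \<in> I}"
  have sB: "subgroup B G" unfolding B_def by (rule h.subgroup_preimage[OF sI])
  have cB: "card B = card I * card N"
    unfolding B_def using h.card_preimage[OF sI] subgroup.subset[OF sI]
    by (simp add: N.kernel_Mod carrier_FactGroup)
  have AB: "A \<subseteq> B" using subgroup.subset[OF sA] by (auto simp: B_def I_def)
  define e where "e = card (rcosets\<^bsub>G Mod N\<^esub> I)"
  have e: "e * card I = card (rcosets N)"
    using F.lagrange[OF sI] by (simp add: e_def order_def FactGroup_def)
  obtain c where c: "card B = card A * c" using card_subgroup_dvd[OF sA sB AB] by (auto elim: dvdE)
  have og: "order G > 0" using fin order_gt_0_iff_finite by blast
  have pos: "card A > 0" "card N > 0" using card_subgroup_pos[OF fin] sA N.subgroup_axioms by auto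
  have "card (rcosets A) * card A = e * (card I * card N)"
    using lagrange[OF sA] lagrange[OF N.subgroup_axioms] e by (simp add: mult.assoc[symmetric])
  also have "\<dots> = (e * c) * card A" using c cB by (simp add: mult_ac)
  finally have iA': "card (rcosets A) = e * c" using pos by simp
  have nz: "card (rcosets A) \<noteq> 0" "card (rcosets N) \<noteq> 0"
    using lagrange[OF sA] lagrange[OF N.subgroup_axioms] og by (metis less_irrefl mult_0)+
  have "e = 1"
  proof (rule ccontr)
    assume "e \<noteq> 1"
    then obtain r where r: "Factorial_Ring.prime r" "r dvd e" using prime_factor_nat by blast
    have "r dvd card (rcosets N)" "r dvd card (rcosets A)" using r(2) e iA' by (metis dvd_mult2)+
    then have "r \<in> prime_factors (card (rcosets N))" "r \<in> prime_factors (card (rcosets A))"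
      using r(1) nz by (auto simp: prime_factors_dvd)
    then show False using N(2) iA by blast
  qed
  then have "card I = card (carrier (G Mod N))" using e by (simp add: FactGroup_def)
  then show ?thesis
    using card_subset_eq[OF _ subgroup.subset[OF sI]] fin unfolding I_def by (simp add: carrier_FactGroup)
qed

text \<open>The nilpotent Hall subgroup for \<open>s\<close> maps onto the quotient by the large
  normal subgroup \<open>N\<close>, so that quotient is nilpotent and the residual lies in
  \<open>N\<close>. The multiplicities of \<open>card N\<close> then bound those of the
  residual.\<close>

lemma (in group) nilpotent_residual_multiplicity:
  assumes fin: "finite (carrier G)" and \<sigma>: "\<Union>\<sigma> = {p :: nat. Factorial_Ring.prime p}"
    and L: "sigma_embedded_orders \<sigma> G"
    and A: "complete_Hall_sigma_set \<sigma> \<H> G"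
    and nil: "\<And>A. A \<in> \<H> - {{\<one>}} \<Longrightarrow> nilpotent (G\<lparr>carrier := A\<rparr>)"
    and s: "s \<in> \<sigma>" "p \<in> s" "p dvd order G"
  shows "multiplicity p (card (nilpotent_residual G)) \<le> 1"
    and "\<And>r. r \<in> s - {p} \<Longrightarrow> multiplicity r (card (nilpotent_residual G)) = 0"
proof -
  have p: "Factorial_Ring.prime p" using s \<sigma> by blast
  have og: "order G > 0" using fin order_gt_0_iff_finite by blast
  have "s \<in> sigma_of \<sigma> (order G)" using s p og by (auto simp: sigma_of_def prime_factors_dvd)
  then obtain A where A: "A \<in> \<H>" "Hall_subgroup s A G"
    using A unfolding complete_Hall_sigma_set_def by blast
  have sA: "subgroup A G" using A by (simp add: Hall_subgroup_def)
  \<comment> \<open>Nilpotency is given for nontrivial members of \<open>\<H>\<close>. A trivial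
    \<open>A\<close> would have index \<open>order G\<close>, which is divisible by
    \<open>p \<in> s\<close>.\<close>
  have "A \<noteq> {\<one>}"
  proof
    assume "A = {\<one>}"
    then have "card (rcosets A) = order G" using lagrange[OF sA] by simp
    then have "p \<in> prime_factors (card (rcosets A))" using p s(3) og by (auto simp: prime_factors_dvd)
    then show False using A(2) s(2) by (auto simp: Hall_subgroup_def)
  qed
  then have nA: "nilpotent (G\<lparr>carrier := A\<rparr>)" using nil A(1) by blast
  obtain N where N: "N \<lhd> G" "multiplicity p (card N) = 1"
    "\<And>r. r \<in> s - {p} \<Longrightarrow> multiplicity r (card N) = 0" "prime_factors (card (rcosets N)) \<subseteq> s"
    using sigma_embedded_orders_imp_large_normal[OF fin \<sigma> L s] by blast
  interpret N: normal N G by (rule N)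
  interpret h: group_hom G "G Mod N" "\<lambda>x. N #> x" by (rule N.group_hom_Mod)
  interpret hA: group_hom "G\<lparr>carrier := A\<rparr>" "G Mod N" "\<lambda>x. N #> x"
    using subgroup.subset[OF sA]
    by (intro group_hom.intro group_hom_axioms.intro subgroup_imp_group[OF sA] N.factorgroup_is_group homI)
      (auto simp: subset_iff simp del: mult_FactGroup)
  have "nilpotent (G Mod N)"
    using hA.nilpotent_img[OF _ nA] Hall_subgroup_onto_quotient[OF fin A(2) N(1,4)] by simp
  then have DN: "nilpotent_residual G \<subseteq> N" unfolding nilpotent_residual_def using N(1) by blast
  have sD: "subgroup (nilpotent_residual G) G"
    using nilpotent_residual_normal[OF fin] normal_imp_subgroup by blast
  have dvd: "card (nilpotent_residual G) dvd card N"
    using card_subgroup_dvd[OF sD N.subgroup_axioms DN] .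
  have "card N \<noteq> 0" using card_subgroup_pos[OF fin N.subgroup_axioms] by simp
  then have le: "multiplicity r (card (nilpotent_residual G)) \<le> multiplicity r (card N)" for r
    using dvd dvd_imp_multiplicity_le by blast
  show "multiplicity p (card (nilpotent_residual G)) \<le> 1" using le[of p] N(2) by simp
  show "multiplicity r (card (nilpotent_residual G)) = 0" if "r \<in> s - {p}" for r
    using le[of r] N(3)[OF that] by simp
qed

lemma (in group) sigma_embedded_orders_imp_cyclic_squarefree:
  assumes fin: "finite (carrier G)" and \<sigma>: "\<Union>\<sigma> = {p :: nat. Factorial_Ring.prime p}"
    and L: "sigma_embedded_orders \<sigma> G"
    and Hall: "complete_Hall_sigma_set \<sigma> \<H> G"
    and nil: "\<And>A. A \<in> \<H> - {{\<one>}} \<Longrightarrow> nilpotent (G\<lparr>carrier := A\<rparr>)"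
  shows "cyclic_group (subgroup_generated G (nilpotent_residual G))"
    and "squarefree (card (nilpotent_residual G))"
    and "\<And>s. s \<in> \<sigma> \<Longrightarrow> s \<inter> prime_factors (card (nilpotent_residual G)) \<noteq> {} \<Longrightarrow>
      card (s \<inter> prime_factors (order G)) = 1"
proof -
  define D where "D = nilpotent_residual G"
  have nD: "D \<lhd> G" unfolding D_def by (rule nilpotent_residual_normal[OF fin])
  interpret D: normal D G by (rule nD)
  have D0: "card D > 0" using card_subgroup_pos[OF fin D.subgroup_axioms] .
  have og: "order G > 0" using fin order_gt_0_iff_finite by blast
  have Ddvd: "card D dvd order G" using lagrange[OF D.subgroup_axioms] by (metis dvd_triv_right)
  have finD: "finite D" using fin D.subset finite_subset by blast
  note mult = nilpotent_residual_multiplicity[OF fin \<sigma> L Hall nil, folded D_def]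
  have one: "multiplicity p (card D) = 1" if p: "p \<in> prime_factors (card D)" for p
  proof -
    have pp: "Factorial_Ring.prime p" "p dvd card D" using p by auto
    then obtain s where s: "s \<in> \<sigma>" "p \<in> s" using \<sigma> by blast
    have "multiplicity p (card D) \<le> 1" using mult(1)[OF _ s] pp(2) Ddvd dvd_trans by blast
    moreover have "multiplicity p (card D) > 0" using p by (simp add: prime_factors_multiplicity)
    ultimately show ?thesis by simp
  qed
  then have sq: "squarefree (card D)" using squarefree_factorial_semiring'[of "card D"] D0 by auto
  have "D \<subseteq> derived G (carrier G)" unfolding D_def by (rule nilpotent_residual_subset_derived)
  then have "\<exists>x\<in>D. ord x = card D"
    using squarefree_normal_in_derived_cyclic[OF is_group fin nD _ sq] by blast
  then show "cyclic_group (subgroup_generated G (nilpotent_residual G))"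
    unfolding D_def[symmetric]
    using group.cyclic_group_iff_ord[OF subgroup_imp_group[OF D.subgroup_axioms]] finD
    by (simp add: subgroup_generated_subgroup[OF D.subgroup_axioms] ord_subgroup[OF D.subgroup_axioms] order_def)
  show "squarefree (card (nilpotent_residual G))" using sq unfolding D_def .
  fix s assume s: "s \<in> \<sigma>" "s \<inter> prime_factors (card (nilpotent_residual G)) \<noteq> {}"
  then obtain p where p: "p \<in> s" "p \<in> prime_factors (card D)" unfolding D_def by blast
  have "r = p" if r: "r \<in> s \<inter> prime_factors (order G)" for r
  proof (rule ccontr)
    assume "r \<noteq> p"
    \<comment> \<open>The multiplicity bound is applied with the roles of the primes exchanged:
      starting from \<open>r\<close> it excludes \<open>p\<close> from
      \<open>card D\<close>.\<close>
    then have "multiplicity p (card D) = 0"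
      using mult(2)[OF _ s(1), of r p] r p(1) by auto
    then show False using one[OF p(2)] by simp
  qed
  moreover have "p \<in> s \<inter> prime_factors (order G)"
    using p Ddvd og by (auto simp: prime_factors_dvd dest: dvd_trans)
  ultimately have "s \<inter> prime_factors (order G) = {p}" by blast
  then show "card (s \<inter> prime_factors (order G)) = 1" by simp
qed

section \<open>Backward direction: constructing embedded subgroups\<close>

lemma (in group) cyclic_squarefree_imp_sigma_embedded_orders:
  assumes fin: "finite (carrier G)"
    and cyc: "cyclic_group (subgroup_generated G (nilpotent_residual G))"
    and sqD: "squarefree (card (nilpotent_residual G))"
    and one: "\<And>s. s \<in> \<sigma> \<Longrightarrow> s \<inter> prime_factors (card (nilpotent_residual G)) \<noteq> {} \<Longrightarrow>
      card (s \<inter> prime_factors (order G)) = 1"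
  shows "sigma_embedded_orders \<sigma> G"
proof -
  define D where "D = nilpotent_residual G"
  have nD: "D \<lhd> G" unfolding D_def by (rule nilpotent_residual_normal[OF fin])
  interpret D: normal D G by (rule nD)
  have D0: "card D > 0" using card_subgroup_pos[OF fin D.subgroup_axioms] .
  have og: "order G > 0" using fin order_gt_0_iff_finite by blast
  have Ddvd: "card D dvd order G" using lagrange[OF D.subgroup_axioms] by (metis dvd_triv_right)
  have finD: "finite D" using fin D.subset finite_subset by blast
  note R = cyc[folded D_def] sqD[folded D_def] one[folded D_def]
  note sq = R(2)
  have "\<exists>A. H_sigma_normally_embedded \<sigma> A G \<and> card A = card H" if H: "subgroup H G" for H
  proof -
    have H0: "card H > 0" using card_subgroup_pos[OF fin H] .
    have Hdvd: "card H dvd order G" using lagrange[OF H] by (metis dvd_triv_right)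
    define T where "T = {p. Factorial_Ring.prime p \<and> p dvd card D \<and> \<not> p dvd card H}"
    have finT: "finite T" using finite_divisors_nat[OF D0] by (rule finite_subset[rotated]) (auto simp: T_def)
    define k where "k = \<Prod>T"
    have kD: "k dvd card D" unfolding k_def by (rule prod_distinct_primes_dvd[OF finT]) (auto simp: T_def)
    have k0: "k > 0" using kD D0 by (cases k) auto
    have copH: "coprime k (card H)"
      unfolding k_def by (rule prod_coprime_left) (auto simp: T_def intro: prime_imp_coprime)
    have "k * card H dvd order G"
      using divides_mult[OF dvd_trans[OF kD Ddvd] Hdvd copH] .
    \<comment> \<open>Each prime of the square-free number \<open>card D\<close> divides
      \<open>card H\<close> or belongs to \<open>T\<close>, and so divides \<open>k\<close>.\<close>
    moreover have DkH: "card D dvd k * card H"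
    proof -
      have "p dvd k * card H" if p: "Factorial_Ring.prime p" "p dvd card D" for p
      proof (cases "p dvd card H")
        case False
        then have "p \<in> T" using p by (simp add: T_def)
        then have "p dvd k" unfolding k_def using dvd_prodI[OF finT, of p "\<lambda>p. p"] by simp
        then show ?thesis by (rule dvd_mult2)
      qed simp
      moreover have "finite {p. Factorial_Ring.prime p \<and> p dvd card D}"
        using finite_divisors_nat[OF D0] by (rule finite_subset[rotated]) auto
      ultimately have "\<Prod>{p. Factorial_Ring.prime p \<and> p dvd card D} dvd k * card H"
        by (intro prod_distinct_primes_dvd) auto
      then show ?thesis using squarefree_nat_eq_prod_primes[OF sq] by simp
    qed
    \<comment> \<open>The quotient \<open>n\<close> is the order that a normal subgroup of
      \<open>G Mod D\<close> must have for its preimage to have order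
      \<open>k * card H\<close>.\<close>
    then obtain n where n: "k * card H = n * card D" by (metis dvd_def mult.commute)
    have F: "order (G Mod D) * card D = order G"
      using lagrange[OF D.subgroup_axioms] by (simp add: order_def FactGroup_def)
    have "n dvd order (G Mod D)"
    proof -
      have "n * card D dvd order (G Mod D) * card D"
        using \<open>k * card H dvd order G\<close> n F by simp
      then show ?thesis using D0 by simp
    qed
    moreover have "finite (carrier (G Mod D))" using fin by (simp add: carrier_FactGroup)
    moreover have "nilpotent (G Mod D)"
      unfolding D_def by (rule nilpotent_Mod_nilpotent_residual[OF fin])
    ultimately obtain M where M: "M \<lhd> G Mod D" "card M = n"
      using nilpotent_normal_subgroup_of_order[OF D.factorgroup_is_group] by blast
    interpret h: group_hom G "G Mod D" "\<lambda>x. D #> x" by (rule D.group_hom_Mod)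
    have sM: "subgroup M (G Mod D)" using M(1) normal_imp_subgroup by blast
    define N where "N = {x \<in> carrier G. D #> x \<in> M}"
    have nN: "N \<lhd> G" unfolding N_def by (rule h.normal_preimage[OF M(1)])
    interpret N: normal N G by (rule nN)
    have cN: "card N = k * card H"
      unfolding N_def n using h.card_preimage[OF sM] subgroup.subset[OF sM] M(2)
      by (simp add: D.kernel_Mod carrier_FactGroup)
    have DN: "D \<subseteq> N"
    proof
      fix x assume x: "x \<in> D"
      then have xc: "x \<in> carrier G" by simp
      have "D #> x \<in> M"
        using subgroup.one_closed[OF sM] coset_join2[OF xc D.subgroup_axioms x] by (simp only: one_FactGroup)
      with xc show "x \<in> N" by (simp only: N_def mem_Collect_eq)
    qed
    obtain K where K: "K \<lhd> G" "K \<subseteq> D" "card K = k" "\<And>a b. a \<in> K \<Longrightarrow> b \<in> K \<Longrightarrow> a \<otimes> b = b \<otimes> a"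
      by (rule squarefree_cyclic_normal_subgroup_of_order[OF fin nD sq R(1) kD]) (rule that)
    let ?N = "G\<lparr>carrier := N\<rparr>"
    have "K \<lhd> ?N"
      using normal_restrict_supergroup[OF N.subgroup_axioms K(1)] K(2) DN by blast
    then interpret K: normal K ?N .
    have idx: "card (rcosets\<^bsub>?N\<^esub> K) = card H"
      using K.lagrange[OF K.subgroup_axioms] cN K(3) k0 by (simp add: order_def mult.commute)
    obtain A where A: "subgroup A ?N" "card A * card K = order ?N"
    proof (rule K.abelian_normal_complement)
      show "finite (carrier ?N)" using fin N.subset finite_subset by auto
      show "a \<otimes>\<^bsub>?N\<^esub> b = b \<otimes>\<^bsub>?N\<^esub> a" if "a \<in> K" "b \<in> K" for a b using K(4) that by simp
      show "coprime (card K) (card (rcosets\<^bsub>?N\<^esub> K))" using idx K(3) copH by simp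
    qed blast
    have cA: "card A = card H" using A(2) cN K(3) k0 by (simp add: order_def mult.commute)
    have iA: "card (rcosets\<^bsub>?N\<^esub> A) = k"
      using K.lagrange[OF A(1)] cN cA H0 by (simp add: order_def)
    \<comment> \<open>A block meeting both sets of primes contains a prime of \<open>card D\<close>,
      hence only one prime of \<open>order G\<close>. That prime would divide both \<open>k\<close>
      and \<open>card H\<close>, which are coprime.\<close>
    have "sigma_of \<sigma> (card H) \<inter> sigma_of \<sigma> k = {}"
    proof (rule ccontr)
      assume "sigma_of \<sigma> (card H) \<inter> sigma_of \<sigma> k \<noteq> {}"
      then obtain s r p where s: "s \<in> \<sigma>" and r: "r \<in> s" "r \<in> prime_factors (card H)"
        and p: "p \<in> s" "p \<in> prime_factors k"
        by (auto simp: sigma_of_def)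
      have pp: "Factorial_Ring.prime p" "p dvd k" using p(2) by auto
      then have "p dvd card D" using kD dvd_trans by blast
      then have "p \<in> prime_factors (card D)" using pp D0 by (auto simp: prime_factors_dvd)
      then have "card (s \<inter> prime_factors (order G)) = 1" using R(3)[OF s] p(1) by blast
      moreover have "p \<in> s \<inter> prime_factors (order G)"
        using p(1) pp \<open>p dvd card D\<close> Ddvd og by (auto simp: prime_factors_dvd dest: dvd_trans)
      moreover have "r \<in> s \<inter> prime_factors (order G)"
        using r Hdvd og by (auto simp: prime_factors_dvd dest: dvd_trans)
      ultimately have "r = p" by (metis card_1_singletonE singletonD)
      then have "p dvd card H" using r(2) by auto
      then have "is_unit p" using pp(2) copH coprime_common_divisor by blast
      then show False using pp(1) by simp
    qed
    then have "sigma_Hall_subgroup \<sigma> A ?N"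
      using A(1) by (simp add: sigma_Hall_subgroup_def cA iA)
    then show ?thesis unfolding H_sigma_normally_embedded_def using nN cA by blast
  qed
  then show ?thesis by (simp add: sigma_embedded_orders_def)
qed

theorem corollary1p5:
  fixes G :: "('a, 'b) monoid_scheme" and \<sigma> :: "nat set set" and \<H> :: "'a set set"
  assumes "partition_on {p :: nat. Factorial_Ring.prime p} \<sigma>"
    and "group G" and "finite (carrier G)"
    and "complete_Hall_sigma_set \<sigma> \<H> G" and "{\<one>\<^bsub>G\<^esub>} \<in> \<H>"
    and "\<And>A. A \<in> \<H> - {{\<one>\<^bsub>G\<^esub>}} \<Longrightarrow> nilpotent (G\<lparr>carrier := A\<rparr>)"
  shows "(\<forall>H. subgroup H G \<longrightarrow>
            (\<exists>A. H_sigma_normally_embedded \<sigma> A G \<and> card A = card H)) \<longleftrightarrow>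
         (cyclic_group (subgroup_generated G (nilpotent_residual G)) \<and>
          squarefree (card (nilpotent_residual G)) \<and>
          (\<forall>s \<in> \<sigma>. s \<inter> prime_factors (card (nilpotent_residual G)) \<noteq> {} \<longrightarrow>
             card (s \<inter> prime_factors (order G)) = 1))"
proof -
  interpret group G by fact
  note fin = \<open>finite (carrier G)\<close>
  have \<sigma>: "\<Union>\<sigma> = {p :: nat. Factorial_Ring.prime p}" using assms(1) partition_onD1 by metis
  show ?thesis
    unfolding sigma_embedded_orders_def[symmetric]
    using sigma_embedded_orders_imp_cyclic_squarefree[OF fin \<sigma> _ assms(4,6)]
      cyclic_squarefree_imp_sigma_embedded_orders[OF fin, of \<sigma>] by blast
qed

end
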